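(* Let $\{(a_i,b_i)\}_{i=1}^m\subset(0,\infty)^2$ be a finite set, $\{w_i\}_{i=1}^m$ a probability vector with all $w_i>0$, and let $(i_n)_{n\ge2}$ be an i.i.d. sequence of indices in $\{1,\dots,m\}$ with law $(w_i)_{i=1}^m$. Consider the random sequence $\{x_n\}_{n=0}^\infty$ defined by $$x_0=x_1=1,\qquad x_{n+1}=a_{i_{n+1}}x_n+b_{i_{n+1}}x_{n-1}\quad(n\ge1).$$ Let $M_i=\begin{pmatrix}0&1\\ b_i&a_i\end{pmatrix}$. Then the matrices $\{M_iM_j\}_{i,j=1}^m$ are positive, and $$\lim_{n\to\infty}\sqrt[n]{x_n}=\exp\!\left(\frac12\sum_{k=0}^\infty\big(T^k\boldsymbol v\big)_0\right)\quad\text{almost surely},$$ where $T$ and $\boldsymbol v$ are the infinite matrix and vector associated with the family $\{M_iM_j\}_{i,j=1}^m$ and the weights $(w_iw_j)_{i,j=1}^m$.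
   Context: $\mathbb N_0=\{0,1,2,\dots\}$. A matrix is positive if all its entries are $>0$. Powers use the convention $0^0=1$. $\mathrm{PGL}_2(\mathbb R)=\mathrm{GL}_2(\mathbb R)/\sim$, where $A\sim B$ iff $A=tB$ for some $t\in\mathbb R\setminus\{0\}$. The class $[M]$ of $M=\begin{pmatrix}\alpha&\beta\\ \gamma&\delta\end{pmatrix}$ is identified with the Möbius transformation $x\mapsto\frac{\alpha x+\beta}{\gamma x+\delta}$ of the Riemann sphere; for $f=[M]$ put $f^{\top}=[M^{\top}]$. Define $$F\begin{pmatrix}p&q\\ r&s\end{pmatrix}=\frac12\begin{pmatrix}p-q-r+s&p+q-r-s\\ p-q+r-s&p+q+r+s\end{pmatrix}.$$ $T$ and $\boldsymbol v$ associated with a finite family $\{B_\iota\}_{\iota\in I}$ of invertible positive $2\times2$ matrices and a probability vector $(\omega_\iota)_{\iota\in I}$: let $g_\iota=[F(B_\iota)]$. For $x,c\in\mathbb C$, $|x|\le1$, let $v(x;c)$ be the sequence indexed by $\mathbb N_0$ with $(v(x;c))_0=c$, $(v(x;c))_n=-\frac{(-x)^n}n$ for $n\ge1$. Then $\boldsymbol v=\sum_\iota\omega_\iota\,v\big(g_\iota(0);\tfrac12\log(\det F(B_\iota)/g_\iota'(0))\big)$ (the argument of the logarithm is positive), and $T=(b_{k,n})_{k,n\in\mathbb N_0}$ with $b_{k,0}=0$ for $k\ge0$, $b_{0,n}=\sum_\iota\omega_\iota(g_\iota^{\top}(0))^n$ for $n\ge1$, and for $k,n\ge1$ $$b_{k,n}=\sum_\iota\omega_\iota\sum_{\ell=1}^{\min\{k,n\}}\binom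 n\ell\binom{k-1}{\ell-1}(g_\iota^{\top}(0))^{n-\ell}(-g_\iota(0))^{k-\ell}(g_\iota'(0))^{\ell}.$$ $T$ acts by $(Tu)_k=\sum_{n\ge0}b_{k,n}u_n$; it is a well-defined linear operator on the linear span $V$ of all $v(x;c)$, $|x|\le 1$, so $T^k\boldsymbol v$ makes sense, and $(\cdot)_0$ is the $0$-th coordinate. *)

theory Defs
  imports "HOL-Probability.Probability"
begin

definition mat2 :: "real \<Rightarrow> real \<Rightarrow> real \<Rightarrow> real \<Rightarrow> real^2^2" where
  "mat2 p q r s = vector [vector [p, q], vector [r, s]]"

definition positive_matrix :: "real^2^2 \<Rightarrow> bool" where
  "positive_matrix A \<longleftrightarrow> (\<forall>i j. A $ i $ j > 0)"

definition F_mat :: "real^2^2 \<Rightarrow> real^2^2" where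
  "F_mat A = (let p = A$1$1; q = A$1$2; r = A$2$1; s = A$2$2 in
     mat2 ((p - q - r + s) / 2) ((p + q - r - s) / 2)
          ((p - q + r - s) / 2) ((p + q + r + s) / 2))"

text \<open>The element \<open>[A]\<close> of \<open>PGL\<^sub>2(\<real>)\<close> is represented by the Moebius transformation it is
  identified with; \<open>[A]\<^sup>\<top>\<close> is the transformation of the transposed matrix. Both are
  independent of the representative \<open>A\<close>, see \<open>mat_moebius_scaleR\<close> below. The value at infinity
  and the pole of the transformation are irrelevant here: it is only evaluated, and
  differentiated, at 0, for matrices \<open>F_mat B\<close> or \<open>(F_mat B)\<^sup>\<top>\<close> with \<open>B\<close> positive, and these have
  a positive lower right entry.\<close>

definition mat_moebius :: "real^2^2 \<Rightarrow> complex \<Rightarrow> complex" where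
  "mat_moebius A = moebius (of_real (A$1$1)) (of_real (A$1$2)) (of_real (A$2$1)) (of_real (A$2$2))"

lemma mat_moebius_scaleR:
  assumes "t \<noteq> 0"
  shows "mat_moebius (t *\<^sub>R A) = mat_moebius A"
    and "mat_moebius (transpose (t *\<^sub>R A)) = mat_moebius (transpose A)"
proof -
  have *: "mat_moebius (t *\<^sub>R A) = mat_moebius A" for A
  proof
    fix z
    have "moebius (of_real t * a) (of_real t * b) (of_real t * c) (of_real t * d) z
            = moebius a b c d z" for a b c d :: complex
      using assms unfolding moebius_def
      by (simp add: mult.assoc flip: distrib_left)
    then show "mat_moebius (t *\<^sub>R A) z = mat_moebius A z"
      by (simp add: mat_moebius_def)
  qed
  have "transpose (t *\<^sub>R A) = t *\<^sub>R transpose A"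
    by (simp add: transpose_def vec_eq_iff)
  then show "mat_moebius (t *\<^sub>R A) = mat_moebius A"
    and "mat_moebius (transpose (t *\<^sub>R A)) = mat_moebius (transpose A)"
    using * by auto
qed

lemma F_mat_lower_right_pos:
  assumes "positive_matrix A"
  shows "F_mat A $ 2 $ 2 > 0"
  using assms by (simp add: positive_matrix_def F_mat_def mat2_def Let_def add_pos_pos)

lemma log_argument_pos:
  assumes "positive_matrix A" "det A \<noteq> 0"
  shows "of_real (det (F_mat A)) / deriv (mat_moebius (F_mat A)) 0
           = complex_of_real ((F_mat A $ 2 $ 2)\<^sup>2)"
proof -
  define C where "C = F_mat A"
  have pos: "C $ 2 $ 2 > 0"
    using F_mat_lower_right_pos[OF assms(1)] by (simp add: C_def)
  have "det C = det A"
    by (simp add: C_def F_mat_def mat2_def Let_def det_2 field_simps)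
  then have det: "det C \<noteq> 0" using assms(2) by simp
  have "(mat_moebius C has_field_derivative of_real (det C) / of_real ((C $ 2 $ 2)\<^sup>2)) (at 0)"
    unfolding mat_moebius_def moebius_def using pos
    by (auto intro!: derivative_eq_intros simp: det_2 power2_eq_square)
  then have "deriv (mat_moebius C) 0 = of_real (det C) / of_real ((C $ 2 $ 2)\<^sup>2)"
    by (rule DERIV_imp_deriv)
  then show ?thesis
    using det pos unfolding C_def by simp
qed

definition v_seq :: "complex \<Rightarrow> complex \<Rightarrow> nat \<Rightarrow> complex" where
  "v_seq x c n = (if n = 0 then c else - ((- x) ^ n / of_nat n))"

text \<open>In the next two definitions \<open>B\<close> is a family of invertible positive matrices indexed by the
  finite set \<open>I\<close>, with probability weights \<open>\<omega>\<close>. The argument of the logarithm is then a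
  positive real number (\<open>log_argument_pos\<close>), for which the principal branch is the real logarithm.\<close>

definition bold_v :: "'i set \<Rightarrow> ('i \<Rightarrow> real^2^2) \<Rightarrow> ('i \<Rightarrow> real) \<Rightarrow> nat \<Rightarrow> complex" where
  "bold_v I B \<omega> n = (\<Sum>\<iota>\<in>I. of_real (\<omega> \<iota>) *
     (let g = mat_moebius (F_mat (B \<iota>)) in
        v_seq (g 0) (1/2 * Ln (of_real (det (F_mat (B \<iota>))) / deriv g 0)) n))"

definition T_mat :: "'i set \<Rightarrow> ('i \<Rightarrow> real^2^2) \<Rightarrow> ('i \<Rightarrow> real) \<Rightarrow> nat \<Rightarrow> nat \<Rightarrow> complex" where
  "T_mat I B \<omega> k n =
     (if n = 0 then 0
      else if k = 0 then
        (\<Sum>\<iota>\<in>I. of_real (\<omega> \<iota>) * mat_moebius (transpose (F_mat (B \<iota>))) 0 ^ n)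
      else
        (\<Sum>\<iota>\<in>I. of_real (\<omega> \<iota>) *
           (let g = mat_moebius (F_mat (B \<iota>)); gt = mat_moebius (transpose (F_mat (B \<iota>))) in
              \<Sum>l = 1..min k n. of_nat (n choose l) * of_nat ((k - 1) choose (l - 1)) *
                gt 0 ^ (n - l) * (- g 0) ^ (k - l) * deriv g 0 ^ l)))"

definition inf_mat_apply :: "(nat \<Rightarrow> nat \<Rightarrow> complex) \<Rightarrow> (nat \<Rightarrow> complex) \<Rightarrow> nat \<Rightarrow> complex" where
  "inf_mat_apply A u k = (\<Sum>n. A k n * u n)"

end

theory Submission
  imports Defs "HOL-Complex_Analysis.Complex_Analysis"
begin

text \<open>
  Identify a bounded sequence \<open>u\<close> with the power series \<open>u(z) = \<Sum>n. u n * z^n\<close> on the unit disc. Then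
  \<open>(T u)(z) = \<Sum>\<iota>. \<omega> \<iota> * u(h \<iota> z) - u(0)\<close>, where \<open>h \<iota>\<close> is the transformation of \<open>(F (B \<iota>))\<^sup>\<top>\<close>, which
  maps the closed disc into a smaller one, and \<open>v(z)\<close> is the mean logarithmic growth of one step of the random
  product of the transposed matrices started in direction \<open>z\<close>. Hence the partial sums of
  \<open>(T\<^sup>k v)\<^sub>0\<close> telescope to the mean growth in step \<open>k + 1\<close> from \<open>z = 0\<close>. In the coordinate
  \<open>\<theta> = ln ((1 + z) / (1 - z))\<close> every \<open>h \<iota>\<close> is a contraction of the real line, so these means converge,
  and by averaging the limit is the growth rate of the expected logarithm of long products.
  For almost sure convergence the recurrence is cut into blocks: the logarithmic growth over a block depends on
  the past only up to a bounded error, so Hoeffding's inequality and the Borel-Cantelli lemma, applied to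
  the independent block contributions, give the rate up to an error that vanishes as the blocks get longer.
\<close>

no_notation fps_nth (infixl \<open>$\<close> 75)

section \<open>Composition operators on bounded coefficient sequences\<close>

text \<open>Near 0 the map is \<gamma> + \<delta> z / (1 + \<beta> z). The binomial theorem expands
  its n-th power in powers of the second summand, and the negative binomial series expands each of
  those. Applied to a transposed matrix this yields the entries of \<open>T_mat\<close>.\<close>

lemma higher_deriv_power_moebius:
  fixes a b c d :: complex
  assumes d: "d \<noteq> 0" and k: "k \<ge> 1"
  shows "(deriv ^^ k) (\<lambda>z. moebius a b c d z ^ n) 0 / fact k =
    (\<Sum>l = 1..min k n. of_nat (n choose l) * of_nat ((k - 1) choose (l - 1)) *
      (b / d) ^ (n - l) * (- (c / d)) ^ (k - l) * ((a * d - b * c) / d\<^sup>2) ^ l)"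
proof -
  define \<beta> \<gamma> \<delta> where "\<beta> = c / d" and "\<gamma> = b / d" and "\<delta> = (a * d - b * c) / d\<^sup>2"
  define I where "I = inverse (1 - fps_const (- \<beta>) * fps_X :: complex fps)"
  have "(\<lambda>z. (\<gamma> + \<delta> * z * inverse (1 - (- \<beta>) * z)) ^ n) has_fps_expansion
          (fps_const \<gamma> + fps_const \<delta> * fps_X * I) ^ n"
    unfolding I_def by (intro fps_expansion_intros) auto
  moreover have "eventually (\<lambda>z. (\<gamma> + \<delta> * z * inverse (1 - (- \<beta>) * z)) ^ n = moebius a b c d z ^ n) (nhds 0)"
  proof -
    have "eventually (\<lambda>z. z \<in> {z. c * z + d \<noteq> 0}) (nhds 0)"
      using d by (intro eventually_nhds_in_open open_Collect_neq continuous_intros) auto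
    then show ?thesis
    proof eventually_elim
      case (elim z)
      have "1 - (- \<beta>) * z = (c * z + d) / d"
        using d by (simp add: \<beta>_def field_simps)
      then have "\<gamma> + \<delta> * z * inverse (1 - (- \<beta>) * z) = \<gamma> + \<delta> * z * (d / (c * z + d))"
        by simp
      also have "\<dots> = (b * (c * z + d) + (a * d - b * c) * z) / (d * (c * z + d))"
      proof -
        have "b / d + D / d\<^sup>2 * z * (d / e) = (b * e + D * z) / (d * e)" if "e \<noteq> 0" for e D
          using d that by (simp add: field_simps power2_eq_square)
        then show ?thesis using elim by (simp add: \<gamma>_def \<delta>_def)
      qed
      also have "b * (c * z + d) + (a * d - b * c) * z = d * (a * z + b)"
        by (simp add: algebra_simps)
      also have "d * (a * z + b) / (d * (c * z + d)) = moebius a b c d z"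
        using d by (simp add: moebius_def)
      finally show ?case by simp
    qed
  qed
  ultimately have "(\<lambda>z. moebius a b c d z ^ n) has_fps_expansion (fps_const \<gamma> + fps_const \<delta> * fps_X * I) ^ n"
    using has_fps_expansion_cong[OF _ refl, of "\<lambda>z. (\<gamma> + \<delta> * z * inverse (1 - (- \<beta>) * z)) ^ n"] by iprover
  then have "(deriv ^^ k) (\<lambda>z. moebius a b c d z ^ n) 0 / fact k = fps_nth ((fps_const \<gamma> + fps_const \<delta> * fps_X * I) ^ n) k"
    by (simp add: fps_nth_fps_expansion)
  also have "(fps_const \<gamma> + fps_const \<delta> * fps_X * I) ^ n = (fps_const \<delta> * fps_X * I + fps_const \<gamma>) ^ n"
    by (simp add: add.commute)
  also have "\<dots> = (\<Sum>l\<le>n. fps_const (of_nat (n choose l) * \<delta> ^ l * \<gamma> ^ (n - l)) * (fps_X ^ l * I ^ l))"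
    unfolding binomial_ring
    by (intro sum.cong) (simp_all add: power_mult_distrib mult_ac fps_const_power fps_of_nat
          flip: fps_const_mult fps_of_nat)
  also have "fps_nth \<dots> k = (\<Sum>l\<le>n. of_nat (n choose l) * \<delta> ^ l * \<gamma> ^ (n - l) * fps_nth (fps_X ^ l * I ^ l) k)"
    by (simp add: fps_sum_nth)
  \<comment> \<open>The term \<open>l = 0\<close> is constant and does not reach the coefficient at
    \<open>k \<ge> 1\<close>; the terms with \<open>l > k\<close> start beyond it.\<close>
  also have "\<dots> = (\<Sum>l = 1..min k n. of_nat (n choose l) * \<delta> ^ l * \<gamma> ^ (n - l) * fps_nth (fps_X ^ l * I ^ l) k)"
    using k by (intro sum.mono_neutral_right) (auto simp: fps_X_power_mult_nth not_le Suc_le_eq)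
  also have "\<dots> = (\<Sum>l = 1..min k n. of_nat (n choose l) * of_nat ((k - 1) choose (l - 1)) *
      \<gamma> ^ (n - l) * (- \<beta>) ^ (k - l) * \<delta> ^ l)"
  proof (intro sum.cong refl)
    fix l assume l: "l \<in> {1..min k n}"
    have "I ^ l = inverse ((1 - fps_const (- \<beta>) * fps_X) ^ l)"
      unfolding I_def by (simp only: fps_inverse_power)
    also have "\<dots> = Abs_fps (\<lambda>k. of_nat ((l + k - 1) choose k) * (- \<beta>) ^ k)"
      using l by (intro one_minus_const_fps_X_neg_power') auto
    finally have "fps_nth (I ^ l) (k - l) = of_nat ((k - 1) choose (k - l)) * (- \<beta>) ^ (k - l)"
      using l by simp
    moreover have "(k - 1) choose (k - l) = (k - 1) choose (l - 1)"
      using l by (subst binomial_symmetric) auto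
    ultimately show "of_nat (n choose l) * \<delta> ^ l * \<gamma> ^ (n - l) * fps_nth (fps_X ^ l * I ^ l) k =
      of_nat (n choose l) * of_nat ((k - 1) choose (l - 1)) * \<gamma> ^ (n - l) * (- \<beta>) ^ (k - l) * \<delta> ^ l"
      using l by (simp add: fps_X_power_mult_nth)
  qed
  finally show ?thesis
    by (simp only: \<beta>_def \<gamma>_def \<delta>_def)
qed

text \<open>The numbers \<open>c n k\<close> are the Taylor coefficients of the n-th power of
  \<open>h\<close>. Cauchy's estimate bounds them by \<open>q ^ n\<close>, so the double series of
  \<open>c n k * u n * z ^ k\<close> is dominated by a product of two geometric series. Summing over
  \<open>k\<close> first gives the composition with \<open>h\<close>, summing over \<open>n\<close>
  first gives the power series of the image sequence.\<close>

lemma bounded_coeff_composition: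
  fixes h :: "complex \<Rightarrow> complex" and u :: "nat \<Rightarrow> complex" and c :: "nat \<Rightarrow> nat \<Rightarrow> complex"
  assumes c_def: "\<And>n k. c n k = (deriv ^^ k) (\<lambda>z. h z ^ n) 0 / fact k"
    and hol: "h holomorphic_on ball 0 1" and cont: "continuous_on (cball 0 1) h"
    and q: "q < 1" and hq: "\<And>z. norm z \<le> 1 \<Longrightarrow> norm (h z) \<le> q"
    and K: "\<And>n. norm (u n) \<le> K"
  shows "summable (\<lambda>n. c n k * u n)"
    and "norm (\<Sum>n. c n k * u n) \<le> K / (1 - q)"
    and "norm z < 1 \<Longrightarrow> (\<lambda>k. (\<Sum>n. c n k * u n) * z ^ k) sums (\<Sum>n. u n * h z ^ n)"
proof -
  have q0: "0 \<le> q" using order_trans[OF norm_ge_zero hq[of 0]] by simp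
  have K0: "0 \<le> K" using K[of 0] norm_ge_zero[of "u 0"] by linarith
  have cn: "norm (c n k) \<le> q ^ n" for n k
  proof -
    \<comment> \<open>Continuity up to the boundary permits radius 1 in Cauchy's inequality, so the
      bound is uniform in \<open>k\<close>.\<close>
    have "norm ((deriv ^^ k) (\<lambda>z. h z ^ n) 0) \<le> fact k * q ^ n / 1 ^ k"
      by (intro Cauchy_inequality holomorphic_intros continuous_intros hol cont)
         (auto simp: norm_power intro!: power_mono hq)
    then show ?thesis
      by (simp add: c_def norm_divide divide_simps mult.commute)
  qed
  have bd: "norm (c n k * u n) \<le> q ^ n * K" for n k
    unfolding norm_mult by (intro mult_mono cn K) (use q0 in auto)
  have geo: "(\<lambda>n. q ^ n * K) sums (1 / (1 - q) * K)"
    using q q0 by (intro sums_mult2 geometric_sums) auto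
  have sn: "summable (\<lambda>n. norm (c n k * u n))" for k
    by (rule summable_comparison_test'[OF sums_summable[OF geo], of 0]) (simp add: bd)
  then show sm: "summable (\<lambda>n. c n k * u n)" for k
    by (rule summable_norm_cancel)
  have "norm (\<Sum>n. c n k * u n) \<le> (\<Sum>n. norm (c n k * u n))"
    by (rule summable_norm[OF sn])
  also have "\<dots> \<le> (\<Sum>n. q ^ n * K)"
    by (rule suminf_le[OF bd sn sums_summable[OF geo]])
  finally show "norm (\<Sum>n. c n k * u n) \<le> K / (1 - q)"
    by (simp add: sums_unique[OF geo, symmetric])
  assume z: "norm z < 1"
  define f where "f = (\<lambda>n k. c n k * u n * z ^ k)"
  have "(\<lambda>n. norm (q ^ n * K)) summable_on UNIV"
    using sums_summable[OF geo] q0 K0 by (intro norm_summable_imp_summable_on) (simp add: abs_mult)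
  moreover have "(\<lambda>k. norm (norm z ^ k)) summable_on UNIV"
    using z by (intro norm_summable_imp_summable_on) (auto simp: norm_power)
  ultimately have "(\<lambda>p. norm (case p of (n,k) \<Rightarrow> q ^ n * K * norm z ^ k)) summable_on UNIV \<times> UNIV"
    by (subst Infinite_Sum.abs_summable_on_Sigma_iff)
       (auto simp: abs_mult power_abs infsum_cmult_right' intro!: summable_on_cmult_right summable_on_cmult_left)
  then have "(\<lambda>p. norm (case p of (n,k) \<Rightarrow> f n k)) summable_on UNIV \<times> UNIV"
  proof (rule Infinite_Sum.abs_summable_on_comparison_test)
    fix p :: "nat \<times> nat"
    obtain n k where p: "p = (n, k)" by force
    have "norm (f n k) \<le> q ^ n * K * norm z ^ k"
      unfolding f_def norm_mult[of _ "z ^ k"] norm_power by (intro mult_right_mono bd) auto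
    also have "\<dots> \<le> norm (q ^ n * K * norm z ^ k)" by simp
    finally show "norm (case p of (n, k) \<Rightarrow> f n k) \<le> norm (case p of (n, k) \<Rightarrow> q ^ n * K * norm z ^ k)"
      by (simp add: p)
  qed
  then have fs: "(\<lambda>(n,k). f n k) summable_on UNIV \<times> UNIV"
    by (rule abs_summable_summable)
  have row: "((\<lambda>k. f n k) has_sum (u n * h z ^ n)) UNIV" for n
  proof -
    have "(\<lambda>k. c n k * (z - 0) ^ k) sums (h z ^ n)"
      unfolding c_def by (rule holomorphic_power_series[where r = 1])
        (use z hol in \<open>auto intro!: holomorphic_intros\<close>)
    then have "(\<lambda>k. u n * (c n k * z ^ k)) sums (u n * h z ^ n)"
      by (intro sums_mult) simp
    moreover have "summable (\<lambda>k. norm (f n k))"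
    proof (rule summable_comparison_test)
      show "\<exists>N. \<forall>k\<ge>N. norm (norm (f n k)) \<le> (q ^ n * K) * norm z ^ k"
        unfolding f_def norm_mult[of _ "z ^ _"] norm_power by (auto intro!: mult_right_mono bd)
      show "summable (\<lambda>k. (q ^ n * K) * norm z ^ k)"
        using z by (intro summable_mult summable_geometric) auto
    qed
    ultimately show ?thesis
      by (intro norm_summable_imp_has_sum) (auto simp: f_def mult_ac)
  qed
  have col: "((\<lambda>n. f n k) has_sum ((\<Sum>n. c n k * u n) * z ^ k)) UNIV" for k
    unfolding f_def
    by (intro norm_summable_imp_has_sum sums_mult2 summable_sums sm)
       (use summable_mult2[OF sn[of k], of "norm z ^ k"] in \<open>simp add: norm_mult norm_power\<close>)
  have rsum: "((\<lambda>n. u n * h z ^ n) has_sum (\<Sum>\<^sub>\<infinity>n. \<Sum>\<^sub>\<infinity>k. f n k)) UNIV"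
    using summable_on_Sigma_banach[OF fs] infsumI[OF row] by simp
  have csum: "((\<lambda>k. (\<Sum>n. c n k * u n) * z ^ k) has_sum (\<Sum>\<^sub>\<infinity>k. \<Sum>\<^sub>\<infinity>n. f n k)) UNIV"
  proof -
    have "(\<lambda>(k,n). f n k) summable_on UNIV \<times> UNIV"
      using fs by (subst summable_on_swap) (simp add: case_prod_unfold)
    from summable_on_Sigma_banach[OF this] show ?thesis
      using infsumI[OF col] by simp
  qed
  have "(\<Sum>\<^sub>\<infinity>k. \<Sum>\<^sub>\<infinity>n. f n k) = (\<Sum>n. u n * h z ^ n)"
    using infsum_swap_banach[OF fs] sums_unique[OF has_sum_imp_sums[OF rsum]] by simp
  then show "(\<lambda>k. (\<Sum>n. c n k * u n) * z ^ k) sums (\<Sum>n. u n * h z ^ n)"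
    using has_sum_imp_sums[OF csum] by simp
qed

section \<open>The disc model of positive matrices\<close>

lemma F_mat_nth [simp]:
  "F_mat A $ 1 $ 1 = (A$1$1 - A$1$2 - A$2$1 + A$2$2) / 2"
  "F_mat A $ 1 $ 2 = (A$1$1 + A$1$2 - A$2$1 - A$2$2) / 2"
  "F_mat A $ 2 $ 1 = (A$1$1 - A$1$2 + A$2$1 - A$2$2) / 2"
  "F_mat A $ 2 $ 2 = (A$1$1 + A$1$2 + A$2$1 + A$2$2) / 2"
  by (simp_all add: F_mat_def mat2_def Let_def)

lemma positive_matrixD:
  assumes "positive_matrix A"
  shows "A$1$1 > 0" "A$1$2 > 0" "A$2$1 > 0" "A$2$2 > 0"
  using assms by (auto simp: positive_matrix_def)

text \<open>This is the map h of the overview. \<open>F_mat A\<close> is the conjugate of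
  \<open>A\<close> by the rotation S with rows (1, -1) and (1, 1), divided by sqrt 2. Its Moebius
  map x -> (x - 1) / (x + 1) carries the right half-plane to the disc, and since S is orthogonal,
  \<open>F_mat\<close> commutes with transposition. So \<open>dual_moebius A\<close> is the action
  of \<open>transpose A\<close> seen in the disc.\<close>

abbreviation dual_moebius :: "real^2^2 \<Rightarrow> complex \<Rightarrow> complex" where
  "dual_moebius A \<equiv> mat_moebius (transpose (F_mat A))"

lemma dual_moebius_eq:
  "dual_moebius A z = (of_real (F_mat A $ 1 $ 1) * z + of_real (F_mat A $ 2 $ 1)) /
     (of_real (F_mat A $ 1 $ 2) * z + of_real (F_mat A $ 2 $ 2))"
  by (simp add: mat_moebius_def moebius_def transpose_def)

text \<open>In the coordinates \<open>((1 + z) / 2, (1 - z) / 2)\<close> the closed unit disc is the set where the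
  first coordinate times the conjugate of the second has nonnegative real part, and a positive
  matrix maps it into the set where this real part is positive.\<close>

lemma norm_numerator_less_denominator:
  assumes A: "positive_matrix A" and z: "norm (z::complex) \<le> 1"
  shows "norm (of_real (F_mat A $ 1 $ 1) * z + of_real (F_mat A $ 2 $ 1)) <
         norm (of_real (F_mat A $ 1 $ 2) * z + of_real (F_mat A $ 2 $ 2))"
proof -
  define p q r s where pqrs: "p = A$1$1" "q = A$1$2" "r = A$2$1" "s = A$2$2"
  note pos = positive_matrixD[OF A, folded pqrs]
  define x y where "x = Re z" and "y = Im z"
  have xy: "x\<^sup>2 + y\<^sup>2 \<le> 1"
    using z power_le_one[of "norm z" 2] by (simp add: x_def y_def cmod_power2)
  \<comment> \<open>With N and D the numerator and the denominator, D + N = p (1 + z) + r (1 - z)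
    and D - N = q (1 + z) + s (1 - z). The expression is the real part of (D + N) times the
    conjugate of D - N, that is, the squared norm of D minus that of N. Its first summand vanishes
    only at z = -1, where the second is positive.\<close>
  have "0 < p * q * ((1 + x)\<^sup>2 + y\<^sup>2) + r * s * ((1 - x)\<^sup>2 + y\<^sup>2) + (p * s + r * q) * (1 - x\<^sup>2 - y\<^sup>2)"
  proof (cases "x = -1")
    case True
    then have "y = 0" using xy by auto
    then show ?thesis using True pos by (simp add: zero_less_mult_iff)
  next
    case False
    then have "0 < (1 + x)\<^sup>2"
      by simp
    then have "0 < (1 + x)\<^sup>2 + y\<^sup>2"
      by (rule add_pos_nonneg) simp
    then show ?thesis
      using pos xy by (intro add_pos_nonneg[of _ "r * s * _"] add_pos_nonneg[of _ "(p * s + r * q) * _"] mult_pos_pos mult_nonneg_nonneg add_nonneg_nonneg) auto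
  qed
  also have "\<dots> = (norm (of_real (F_mat A $ 1 $ 2) * z + of_real (F_mat A $ 2 $ 2)))\<^sup>2 -
      (norm (of_real (F_mat A $ 1 $ 1) * z + of_real (F_mat A $ 2 $ 1)))\<^sup>2"
    by (simp add: cmod_power2 flip: pqrs x_def y_def) (simp add: power2_eq_square field_simps)
  finally show ?thesis
    by (simp add: power_less_imp_less_base)
qed

lemma dual_denominator_nonzero:
  assumes "positive_matrix A" "norm z \<le> 1"
  shows "of_real (F_mat A $ 1 $ 2) * z + of_real (F_mat A $ 2 $ 2) \<noteq> (0::complex)"
  using norm_numerator_less_denominator[OF assms] by (metis norm_zero norm_ge_zero not_less)

lemma dual_moebius_analytic:
  assumes A: "positive_matrix A"
  shows "dual_moebius A holomorphic_on ball 0 1" "continuous_on (cball 0 1) (dual_moebius A)"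
  unfolding dual_moebius_eq using dual_denominator_nonzero[OF A]
  by (auto intro!: holomorphic_intros continuous_intros)

text \<open>The pointwise strict bound becomes uniform because the maximum over the compact disc is
  attained.\<close>

lemma dual_moebius_contracts:
  assumes A: "positive_matrix A"
  obtains q where "q < 1" "\<And>z. norm z \<le> 1 \<Longrightarrow> norm (dual_moebius A z) \<le> q"
proof -
  have "\<exists>w\<in>cball 0 1. \<forall>z\<in>cball 0 1. norm (dual_moebius A z) \<le> norm (dual_moebius A w)"
    using dual_moebius_analytic(2)[OF A] by (intro continuous_attains_sup continuous_intros) auto
  then obtain w where w: "norm w \<le> 1" "\<And>z. norm z \<le> 1 \<Longrightarrow> norm (dual_moebius A z) \<le> norm (dual_moebius A w)"
    by auto
  have "norm (dual_moebius A w) < 1"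
    unfolding dual_moebius_eq norm_divide
    using norm_numerator_less_denominator[OF A w(1)] dual_denominator_nonzero[OF A w(1)]
    by (subst divide_less_eq_1_pos) (simp_all only: zero_less_norm_iff not_False_eq_True)
  then show thesis using that w by blast
qed

section \<open>The matrix T as an averaged composition operator, and the vector v\<close>

lemma deriv_mat_moebius:
  assumes "C $ 2 $ 2 \<noteq> 0"
  shows "deriv (mat_moebius C) 0 = of_real (det C) / of_real ((C $ 2 $ 2)\<^sup>2)"
  unfolding mat_moebius_def moebius_def using assms
  by (intro DERIV_imp_deriv) (auto intro!: derivative_eq_intros simp: det_2 power2_eq_square)

text \<open>For the transposed matrix, the three parameters b / d, c / d and (a d - b c) / d^2 of
  \<open>higher_deriv_power_moebius\<close> are the value of the dual map at 0, the value of g at 0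
  and the derivative of g at 0, exactly the quantities in the definition of
  \<open>T_mat\<close>.\<close>

lemma T_mat_eq:
  assumes B: "\<And>i. i \<in> I \<Longrightarrow> positive_matrix (B i)" and n: "n \<ge> 1"
  shows "T_mat I B \<omega> k n =
    (\<Sum>i\<in>I. of_real (\<omega> i) * ((deriv ^^ k) (\<lambda>z. dual_moebius (B i) z ^ n) 0 / fact k))"
proof (cases "k = 0")
  case True
  then show ?thesis using n by (simp add: T_mat_def)
next
  case False
  show ?thesis
    unfolding T_mat_def Let_def
  proof (simp only: False if_False, subst if_not_P, use n in simp, intro sum.cong refl, goal_cases)
    case (1 i)
    define C where "C = F_mat (B i)"
    have C: "C $ 2 $ 2 > 0" unfolding C_def by (intro F_mat_lower_right_pos B 1)
    have *: "mat_moebius (transpose C) = moebius (of_real (C$1$1)) (of_real (C$2$1)) (of_real (C$1$2)) (of_real (C$2$2))"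
      by (simp add: mat_moebius_def transpose_def)
    have "mat_moebius C 0 = of_real (C$1$2) / of_real (C$2$2)"
      "mat_moebius (transpose C) 0 = of_real (C$2$1) / of_real (C$2$2)"
      by (simp_all add: mat_moebius_def moebius_def transpose_def)
    moreover have "deriv (mat_moebius C) 0 = (of_real (C$1$1) * of_real (C$2$2) - of_real (C$2$1) * of_real (C$1$2)) / (of_real (C$2$2))\<^sup>2"
      using C by (simp add: deriv_mat_moebius det_2)
    moreover have "(deriv ^^ k) (\<lambda>z. mat_moebius (transpose C) z ^ n) 0 / fact k =
        (\<Sum>l = 1..min k n. of_nat (n choose l) * of_nat ((k - 1) choose (l - 1)) *
          (of_real (C$2$1) / of_real (C$2$2)) ^ (n - l) * (- (of_real (C$1$2) / of_real (C$2$2))) ^ (k - l) *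
          ((of_real (C$1$1) * of_real (C$2$2) - of_real (C$2$1) * of_real (C$1$2)) / (of_real (C$2$2))\<^sup>2) ^ l)"
      unfolding * using C False by (intro higher_deriv_power_moebius) auto
    ultimately show ?case
      unfolding C_def[symmetric] by (simp only:)
  qed
qed

text \<open>By \<open>T_mat_eq\<close> and \<open>bounded_coeff_composition\<close>,
  \<open>T_mat\<close> acts as the weighted composition operator; boundedness of the image is what
  permits iteration. The term \<open>u 0\<close> is subtracted because column 0 of
  \<open>T_mat\<close> vanishes, whereas composition preserves constants.\<close>

lemma T_mat_apply:
  assumes I: "finite I" and B: "\<And>i. i \<in> I \<Longrightarrow> positive_matrix (B i)"
    and \<omega>: "(\<Sum>i\<in>I. \<omega> i) = 1" and u: "\<And>n. norm (u n) \<le> K"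
  shows "summable (\<lambda>n. T_mat I B \<omega> k n * u n)"
    and "\<exists>K. \<forall>k. norm (inf_mat_apply (T_mat I B \<omega>) u k) \<le> K"
    and "norm z < 1 \<Longrightarrow> (\<Sum>k. inf_mat_apply (T_mat I B \<omega>) u k * z ^ k) =
           (\<Sum>i\<in>I. of_real (\<omega> i) * (\<Sum>n. u n * dual_moebius (B i) z ^ n)) - u 0"
proof -
  define c where "c = (\<lambda>i n k. (deriv ^^ k) (\<lambda>z. dual_moebius (B i) z ^ n) 0 / fact k)"
  \<comment> \<open>\<open>c i 0 0\<close> is 1 while column 0 of \<open>T_mat\<close> is 0; erasing
    the constant coefficient reconciles the two.\<close>
  define u' where "u' = (\<lambda>n. if n = 0 then 0 else u n)"
  have K0: "0 \<le> K" using order_trans[OF norm_ge_zero u[of 0]] by simp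
  have u': "norm (u' n) \<le> K" for n using u[of n] K0 by (simp add: u'_def)
  have "\<exists>q. q < 1 \<and> (\<forall>z. norm z \<le> 1 \<longrightarrow> norm (dual_moebius (B i) z) \<le> q)" if "i \<in> I" for i
    using dual_moebius_contracts[OF B[OF that]] by metis
  then obtain q where q: "\<And>i. i \<in> I \<Longrightarrow> q i < 1"
    "\<And>i z. i \<in> I \<Longrightarrow> norm z \<le> 1 \<Longrightarrow> norm (dual_moebius (B i) z) \<le> q i"
    by metis
  have c_eq: "c i n k = (deriv ^^ k) (\<lambda>z. dual_moebius (B i) z ^ n) 0 / fact k" for i n k
    by (simp add: c_def)
  have comp: "summable (\<lambda>n. c i n k * u' n)" "norm (\<Sum>n. c i n k * u' n) \<le> K / (1 - q i)"
    "norm z < 1 \<Longrightarrow> (\<lambda>k. (\<Sum>n. c i n k * u' n) * z ^ k) sums (\<Sum>n. u' n * dual_moebius (B i) z ^ n)"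
    if i: "i \<in> I" for i k and z :: complex
    using bounded_coeff_composition[of "c i" "dual_moebius (B i)" "q i" u' K, OF c_eq
        dual_moebius_analytic[OF B[OF i]] q(1)[OF i] q(2)[OF i] u'] by blast+
  have eq: "T_mat I B \<omega> k n * u n = (\<Sum>i\<in>I. of_real (\<omega> i) * (c i n k * u' n))" for k n
  proof (cases "n = 0")
    case True
    then show ?thesis by (simp add: T_mat_def u'_def)
  next
    case False
    then show ?thesis
      by (simp add: T_mat_eq[OF B] c_def u'_def sum_distrib_right mult.assoc)
  qed
  show "summable (\<lambda>n. T_mat I B \<omega> k n * u n)" for k
    unfolding eq by (intro summable_sum summable_mult comp(1))
  have app: "inf_mat_apply (T_mat I B \<omega>) u k = (\<Sum>i\<in>I. of_real (\<omega> i) * (\<Sum>n. c i n k * u' n))" for k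
    unfolding inf_mat_apply_def eq
    by (subst suminf_sum) (auto intro!: summable_mult comp(1) sum.cong suminf_mult)
  have "norm (inf_mat_apply (T_mat I B \<omega>) u k) \<le> (\<Sum>i\<in>I. \<bar>\<omega> i\<bar> * (K / (1 - q i)))" for k
    unfolding app
    by (intro sum_norm_le order_trans[OF norm_mult_ineq] mult_mono comp(2)) auto
  then show "\<exists>K. \<forall>k. norm (inf_mat_apply (T_mat I B \<omega>) u k) \<le> K" by blast
  assume z: "norm z < 1"
  have "(\<lambda>k. \<Sum>i\<in>I. of_real (\<omega> i) * ((\<Sum>n. c i n k * u' n) * z ^ k)) sums
      (\<Sum>i\<in>I. of_real (\<omega> i) * (\<Sum>n. u' n * dual_moebius (B i) z ^ n))"
    by (intro sums_sum sums_mult comp(3) z)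
  then have "(\<Sum>k. inf_mat_apply (T_mat I B \<omega>) u k * z ^ k) =
      (\<Sum>i\<in>I. of_real (\<omega> i) * (\<Sum>n. u' n * dual_moebius (B i) z ^ n))"
    by (simp add: app sums_iff sum_distrib_right mult.assoc)
  also have "\<dots> = (\<Sum>i\<in>I. of_real (\<omega> i) * ((\<Sum>n. u n * dual_moebius (B i) z ^ n) - u 0))"
  proof (intro sum.cong refl, goal_cases)
    case (1 i)
    let ?w = "dual_moebius (B i) z"
    have w: "norm ?w < 1" using q(1)[OF 1] q(2)[OF 1, of z] z by linarith
    have "norm (u n * ?w ^ n) \<le> K * norm ?w ^ n" for n
      unfolding norm_mult norm_power by (intro mult_right_mono u) simp
    moreover have "summable (\<lambda>n. K * norm ?w ^ n)"
      using w by (intro summable_mult summable_geometric) simp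
    ultimately have "summable (\<lambda>n. u n * ?w ^ n)"
      by (rule summable_comparison_test'[where N = 0, rotated])
    moreover have "(\<lambda>n. if n = 0 then u 0 else 0) sums u 0"
      using sums_single[of 0 "\<lambda>_. u 0"] by simp
    ultimately have "(\<lambda>n. u n * ?w ^ n - (if n = 0 then u 0 else 0)) sums ((\<Sum>n. u n * ?w ^ n) - u 0)"
      by (intro sums_diff summable_sums)
    also have "(\<lambda>n. u n * ?w ^ n - (if n = 0 then u 0 else 0)) = (\<lambda>n. u' n * ?w ^ n)"
      by (auto simp: u'_def)
    finally show ?case by (simp add: sums_iff)
  qed
  also have "\<dots> = (\<Sum>i\<in>I. of_real (\<omega> i) * (\<Sum>n. u n * dual_moebius (B i) z ^ n)) - of_real (\<Sum>i\<in>I. \<omega> i) * u 0"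
    by (simp add: right_diff_distrib sum_subtractf sum_distrib_right)
  finally show "(\<Sum>k. inf_mat_apply (T_mat I B \<omega>) u k * z ^ k) =
           (\<Sum>i\<in>I. of_real (\<omega> i) * (\<Sum>n. u n * dual_moebius (B i) z ^ n)) - u 0"
    by (simp add: \<omega>)
qed

text \<open>Write F12 and F22 for the right column of \<open>F_mat (B i)\<close>. The constant term
  of \<open>v_seq\<close> is half the logarithm of F22 squared, so ln F22. The remaining terms are
  the series of ln (1 + x z) with x = F12 / F22, and positivity of the matrix gives
  \<open>\<bar>x\<bar> < 1\<close>. Together they form ln (F12 z + F22).\<close>

lemma bold_v_eq:
  assumes I: "finite I" and B: "\<And>i. i \<in> I \<Longrightarrow> positive_matrix (B i)" "\<And>i. i \<in> I \<Longrightarrow> det (B i) \<noteq> 0"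
  shows "\<exists>K. \<forall>n. norm (bold_v I B \<omega> n) \<le> K"
    and "\<bar>z\<bar> < 1 \<Longrightarrow> (\<Sum>n. bold_v I B \<omega> n * of_real z ^ n) =
           of_real (\<Sum>i\<in>I. \<omega> i * ln (F_mat (B i) $ 1 $ 2 * z + F_mat (B i) $ 2 $ 2))"
proof -
  define x where "x = (\<lambda>i. F_mat (B i) $ 1 $ 2 / F_mat (B i) $ 2 $ 2)"
  define c where "c = (\<lambda>i. ln (F_mat (B i) $ 2 $ 2))"
  have pos: "F_mat (B i) $ 2 $ 2 > 0" if "i \<in> I" for i
    using B(1)[OF that] by (rule F_mat_lower_right_pos)
  have x: "\<bar>x i\<bar> < 1" if "i \<in> I" for i
    using positive_matrixD[OF B(1)[OF that]] by (simp add: x_def abs_less_iff field_simps)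
  have v: "bold_v I B \<omega> n = (\<Sum>i\<in>I. of_real (\<omega> i) * v_seq (of_real (x i)) (of_real (c i)) n)" for n
    unfolding bold_v_def Let_def
  proof (intro sum.cong refl, goal_cases)
    case (1 i)
    have "1/2 * Ln (of_real (det (F_mat (B i))) / deriv (mat_moebius (F_mat (B i))) 0) = of_real (c i)"
    proof -
      have "Ln (complex_of_real (t\<^sup>2)) = of_real (2 * ln t)" if "t > 0" for t
        using that by (subst Ln_of_real) (simp_all add: ln_realpow)
      then show ?thesis
        unfolding log_argument_pos[OF B(1)[OF 1] B(2)[OF 1]] c_def using pos[OF 1] by (simp del: F_mat_nth)
    qed
    moreover have "mat_moebius (F_mat (B i)) 0 = of_real (x i)"
      by (simp add: mat_moebius_def moebius_def x_def)
    ultimately show ?case by simp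
  qed
  have vb: "norm (v_seq (of_real (x i)) (of_real (c i)) n) \<le> \<bar>c i\<bar> + 1" if "i \<in> I" for i n
  proof (cases "n = 0")
    case False
    have "\<bar>x i\<bar> ^ n \<le> 1" using x[OF that] by (intro power_le_one) auto
    moreover have "1 \<le> real n" using False by simp
    ultimately have "\<bar>x i\<bar> ^ n / n \<le> 1"
      by (subst divide_le_eq_1) linarith
    then show ?thesis using False by (simp add: v_seq_def norm_divide norm_power del: divide_le_eq_1 divide_le_eq_1_pos)
  qed (simp add: v_seq_def)
  have "norm (bold_v I B \<omega> n) \<le> (\<Sum>i\<in>I. \<bar>\<omega> i\<bar> * (\<bar>c i\<bar> + 1))" for n
    unfolding v by (intro sum_norm_le order_trans[OF norm_mult_ineq] mult_mono vb) auto
  then show "\<exists>K. \<forall>n. norm (bold_v I B \<omega> n) \<le> K" by blast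
  assume z: "\<bar>z\<bar> < 1"
  have "(\<lambda>n. v_seq (of_real (x i)) (of_real (c i)) n * of_real z ^ n) sums
      of_real (ln (F_mat (B i) $ 1 $ 2 * z + F_mat (B i) $ 2 $ 2))" if "i \<in> I" for i
  proof -
    have xz: "\<bar>x i * z\<bar> < 1"
      using x[OF that] z mult_strict_mono[of "\<bar>x i\<bar>" 1 "\<bar>z\<bar>" 1] by (auto simp: abs_mult)
    have "(\<lambda>n. - ((- of_real (x i * z)) ^ n) / of_nat n) sums ln (1 + complex_of_real (x i * z))"
      using xz by (intro Ln_series') (simp only: norm_of_real)
    moreover have "(\<lambda>n. if n = 0 then complex_of_real (c i) else 0) sums of_real (c i)"
      using sums_single[of 0 "\<lambda>_. complex_of_real (c i)"] by simp
    ultimately have "(\<lambda>n. (if n = 0 then complex_of_real (c i) else 0) + - ((- of_real (x i * z)) ^ n) / of_nat n) sums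
        (of_real (c i) + ln (1 + complex_of_real (x i * z)))"
      by (intro sums_add)
    also have "(\<lambda>n. (if n = 0 then complex_of_real (c i) else 0) + - ((- of_real (x i * z)) ^ n) / of_nat n) =
        (\<lambda>n. v_seq (of_real (x i)) (of_real (c i)) n * of_real z ^ n)"
    proof
      fix n
      have "(- complex_of_real (x i * z)) ^ n = (- of_real (x i)) ^ n * of_real z ^ n"
        by (simp flip: power_mult_distrib)
      then show "(if n = 0 then complex_of_real (c i) else 0) + - ((- of_real (x i * z)) ^ n) / of_nat n =
          v_seq (of_real (x i)) (of_real (c i)) n * of_real z ^ n"
        by (simp add: v_seq_def)
    qed
    also have "ln (1 + complex_of_real (x i * z)) = of_real (ln (1 + x i * z))"
      using xz by (subst Ln_of_real[symmetric]) auto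
    also have "complex_of_real (c i) + of_real (ln (1 + x i * z)) = of_real (ln (F_mat (B i) $ 2 $ 2 * (1 + x i * z)))"
      using xz pos[OF that] by (subst ln_mult_pos) (auto simp: c_def simp del: F_mat_nth)
    also have "F_mat (B i) $ 2 $ 2 * (1 + x i * z) = F_mat (B i) $ 1 $ 2 * z + F_mat (B i) $ 2 $ 2"
      using pos[OF that] by (simp add: x_def distrib_left del: F_mat_nth)
    finally show ?thesis .
  qed
  then have "(\<lambda>n. \<Sum>i\<in>I. of_real (\<omega> i) * (v_seq (of_real (x i)) (of_real (c i)) n * of_real z ^ n)) sums
      (\<Sum>i\<in>I. of_real (\<omega> i) * of_real (ln (F_mat (B i) $ 1 $ 2 * z + F_mat (B i) $ 2 $ 2)))"
    by (intro sums_sum sums_mult)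
  then show "(\<Sum>n. bold_v I B \<omega> n * of_real z ^ n) =
           of_real (\<Sum>i\<in>I. \<omega> i * ln (F_mat (B i) $ 1 $ 2 * z + F_mat (B i) $ 2 $ 2))"
    by (simp add: v sums_iff sum_distrib_right mult.assoc del: F_mat_nth)
qed

section \<open>The mean logarithmic growth as an iterated function system\<close>

text \<open>The n-th power of the Markov operator of a random iterated function system, applied to
  an observable \<open>f\<close>. The state space is left general: logarithmic directions, vectors
  in the plane and a one-point space all occur.\<close>

fun iterated_mean :: "'i set \<Rightarrow> ('i \<Rightarrow> real) \<Rightarrow> ('i \<Rightarrow> 'y \<Rightarrow> 'y) \<Rightarrow> nat \<Rightarrow> ('y \<Rightarrow> real) \<Rightarrow> 'y \<Rightarrow> real" where
  "iterated_mean A w act 0 f y = f y"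
| "iterated_mean A w act (Suc n) f y = (\<Sum>i\<in>A. w i * iterated_mean A w act n f (act i y))"

lemma iterated_mean_eq_sum_lists:
  assumes "finite A"
  shows "iterated_mean A w act n f y =
    (\<Sum>xs | set xs \<subseteq> A \<and> length xs = n. prod_list (map w xs) * f (foldl (\<lambda>y i. act i y) y xs))"
proof (induction n arbitrary: y)
  case 0
  have "{xs. set xs \<subseteq> A \<and> length xs = 0} = {[]}" by auto
  then show ?case by simp
next
  case (Suc n)
  have eq: "{xs. set xs \<subseteq> A \<and> length xs = Suc n} = (\<lambda>(i, xs). i # xs) ` (A \<times> {xs. set xs \<subseteq> A \<and> length xs = n})"
    by (auto simp: image_iff length_Suc_conv)
  have "inj_on (\<lambda>(i, xs). i # xs) (A \<times> {xs. set xs \<subseteq> A \<and> length xs = n})"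
    by (auto simp: inj_on_def)
  then show ?case
    by (simp add: eq sum.reindex Suc sum.cartesian_product sum_distrib_left case_prod_unfold mult_ac)
qed

text \<open>One step of the system of pairs is two steps of the original one. This is the source of
  the factor 1/2 in the final formula.\<close>

lemma iterated_mean_pairs:
  "iterated_mean (A \<times> A) (\<lambda>(i, j). w i * w j) (\<lambda>(i, j) y. act j (act i y)) n f y =
   iterated_mean A w act (2 * n) f y"
  by (induction n arbitrary: y)
     (simp_all add: sum.cartesian_product sum_distrib_left case_prod_unfold mult_ac)

text \<open>The derivative of \<open>g\<close> is (p s - q r) exp t divided by the product of the
  two affine expressions in exp t, and that product is at least (p s + q r) exp t. For positive
  entries the constant is below 1: a crude form of Birkhoff's contraction of the projective
  metric.\<close>

lemma log_ratio_lipschitz: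
  fixes p q r s x y :: real
  assumes pos: "p > 0" "q > 0" "r > 0" "s > 0"
  defines "g \<equiv> \<lambda>x. ln (p * exp x + r) - ln (q * exp x + s)"
  shows "\<bar>g x - g y\<bar> \<le> \<bar>p * s - q * r\<bar> / (p * s + q * r) * \<bar>x - y\<bar>"
proof -
  define g' where "g' = (\<lambda>x. (p * s - q * r) * exp x / ((p * exp x + r) * (q * exp x + s)))"
  have "norm (g x - g y) \<le> \<bar>p * s - q * r\<bar> / (p * s + q * r) * norm (x - y)"
  proof (rule field_differentiable_bound[where S = UNIV and f' = g'])
    fix t :: real
    have e: "p * exp t + r > 0" "q * exp t + s > 0" using pos by (auto intro!: add_pos_pos)
    show "(g has_field_derivative g' t) (at t within UNIV)"
      unfolding g_def g'_def using e
      by (auto intro!: derivative_eq_intros simp: field_simps)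
    have "exp t * (p * s + q * r) \<le> (p * exp t + r) * (q * exp t + s)"
      using pos by (simp add: algebra_simps)
    then have "exp t / ((p * exp t + r) * (q * exp t + s)) \<le> 1 / (p * s + q * r)"
      using e pos by (simp add: divide_simps add_pos_pos)
    then have "\<bar>p * s - q * r\<bar> * (exp t / ((p * exp t + r) * (q * exp t + s))) \<le> \<bar>p * s - q * r\<bar> * (1 / (p * s + q * r))"
      by (intro mult_left_mono) auto
    then show "norm (g' t) \<le> \<bar>p * s - q * r\<bar> / (p * s + q * r)"
      using e by (simp add: g'_def abs_mult)
  qed auto
  then show ?thesis by simp
qed

section \<open>The logarithmic coordinate on the real diameter of the disc\<close>

text \<open>The Cayley transform of exp \<theta>, which is tanh (\<theta> / 2).\<close>

definition disc_coord :: "real \<Rightarrow> real" where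
  "disc_coord \<theta> = (exp \<theta> - 1) / (exp \<theta> + 1)"

lemma disc_coord_bound: "\<bar>disc_coord \<theta>\<bar> < 1"
  using exp_gt_zero[of \<theta>] by (simp add: disc_coord_def abs_less_iff divide_simps add_pos_pos)

lemma disc_coord_0 [simp]: "disc_coord 0 = 0"
  by (simp add: disc_coord_def)

text \<open>The action of \<open>transpose A\<close> on directions, where a positive vector (u, v)
  has direction \<theta> = ln (u / v).\<close>

definition log_act :: "real^2^2 \<Rightarrow> real \<Rightarrow> real" where
  "log_act A \<theta> = ln (A$1$1 * exp \<theta> + A$2$1) - ln (A$1$2 * exp \<theta> + A$2$2)"

text \<open>The increment of ln (u + v) when \<open>transpose A\<close> is applied to a positive
  vector (u, v) of direction \<theta>.\<close>

definition log_growth :: "real^2^2 \<Rightarrow> real \<Rightarrow> real" where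
  "log_growth A \<theta> = ln ((A$1$1 + A$1$2) * exp \<theta> + (A$2$1 + A$2$2)) - ln (exp \<theta> + 1)"

lemma dual_denominator_disc_coord:
  "F_mat A $ 1 $ 2 * disc_coord \<theta> + F_mat A $ 2 $ 2 =
     ((A$1$1 + A$1$2) * exp \<theta> + (A$2$1 + A$2$2)) / (exp \<theta> + 1)"
proof -
  have "exp \<theta> + 1 \<noteq> 0" using exp_gt_zero[of \<theta>] by linarith
  then show ?thesis by (simp add: disc_coord_def) (simp add: field_simps)
qed

lemma dual_numerator_disc_coord:
  "F_mat A $ 1 $ 1 * disc_coord \<theta> + F_mat A $ 2 $ 1 =
     ((A$1$1 - A$1$2) * exp \<theta> + (A$2$1 - A$2$2)) / (exp \<theta> + 1)"
proof -
  have "exp \<theta> + 1 \<noteq> 0" using exp_gt_zero[of \<theta>] by linarith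
  then show ?thesis by (simp add: disc_coord_def) (simp add: field_simps)
qed

lemma dual_moebius_disc_coord:
  assumes A: "positive_matrix A"
  shows "dual_moebius A (of_real (disc_coord \<theta>)) = of_real (disc_coord (log_act A \<theta>))"
proof -
  note pos = positive_matrixD[OF A]
  define x y where "x = A$1$1 * exp \<theta> + A$2$1" and "y = A$1$2 * exp \<theta> + A$2$2"
  have xy: "x > 0" "y > 0" using pos by (auto simp: x_def y_def intro!: add_pos_pos)
  have e: "exp \<theta> + 1 \<noteq> 0" using exp_gt_zero[of \<theta>] by linarith
  have "exp (log_act A \<theta>) = x / y"
    using xy unfolding log_act_def x_def[symmetric] y_def[symmetric] by (simp add: exp_diff)
  then have "disc_coord (log_act A \<theta>) = (x / y - 1) / (x / y + 1)"
    by (simp add: disc_coord_def)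
  also have "\<dots> = ((x - y) / y) / ((x + y) / y)"
    using xy by (simp add: diff_divide_distrib add_divide_distrib)
  finally have "disc_coord (log_act A \<theta>) = (x - y) / (x + y)"
    using xy by simp
  moreover have "(F_mat A $ 1 $ 1 * disc_coord \<theta> + F_mat A $ 2 $ 1) /
      (F_mat A $ 1 $ 2 * disc_coord \<theta> + F_mat A $ 2 $ 2) = (x - y) / (x + y)"
  proof -
    have "(A$1$1 - A$1$2) * exp \<theta> + (A$2$1 - A$2$2) = x - y"
      "(A$1$1 + A$1$2) * exp \<theta> + (A$2$1 + A$2$2) = x + y"
      by (simp_all add: x_def y_def algebra_simps)
    then show ?thesis
      unfolding dual_denominator_disc_coord dual_numerator_disc_coord using e by simp
  qed
  ultimately show ?thesis
    unfolding dual_moebius_eq by (simp del: F_mat_nth flip: of_real_mult of_real_add of_real_divide)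
qed

lemma log_dual_denominator:
  assumes A: "positive_matrix A"
  shows "ln (F_mat A $ 1 $ 2 * disc_coord \<theta> + F_mat A $ 2 $ 2) = log_growth A \<theta>"
  using positive_matrixD[OF A] unfolding dual_denominator_disc_coord log_growth_def
  by (intro ln_divide_pos add_pos_pos mult_pos_pos) auto

section \<open>Mean growth and the series of T for a family of positive matrices\<close>

locale positive_family =
  fixes I :: "'i set" and B :: "'i \<Rightarrow> real^2^2" and \<omega> :: "'i \<Rightarrow> real"
  assumes finite_I: "finite I"
    and pos_B: "\<And>i. i \<in> I \<Longrightarrow> positive_matrix (B i)"
    and det_B: "\<And>i. i \<in> I \<Longrightarrow> det (B i) \<noteq> 0"
    and \<omega>_nonneg: "\<And>i. i \<in> I \<Longrightarrow> \<omega> i \<ge> 0"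
    and \<omega>_sum: "(\<Sum>i\<in>I. \<omega> i) = 1"
begin

definition mean_growth :: "nat \<Rightarrow> real \<Rightarrow> real" where
  "mean_growth k = iterated_mean I \<omega> (\<lambda>i. log_act (B i)) k (\<lambda>\<theta>. \<Sum>i\<in>I. \<omega> i * log_growth (B i) \<theta>)"

lemma mean_growth_simps:
  "mean_growth 0 \<theta> = (\<Sum>i\<in>I. \<omega> i * log_growth (B i) \<theta>)"
  "mean_growth (Suc k) \<theta> = (\<Sum>i\<in>I. \<omega> i * mean_growth k (log_act (B i) \<theta>))"
  by (simp_all add: mean_growth_def)

lemma weighted_sum_le:
  assumes "\<And>i. i \<in> I \<Longrightarrow> f i \<le> C"
  shows "(\<Sum>i\<in>I. \<omega> i * f i) \<le> C"
proof -
  have "(\<Sum>i\<in>I. \<omega> i * f i) \<le> (\<Sum>i\<in>I. \<omega> i * C)"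
    by (intro sum_mono mult_left_mono assms \<omega>_nonneg)
  then show ?thesis by (simp add: \<omega>_sum flip: sum_distrib_right)
qed

lemma weighted_diff_le:
  assumes "\<And>i. i \<in> I \<Longrightarrow> \<bar>f i - g i\<bar> \<le> C"
  shows "\<bar>(\<Sum>i\<in>I. \<omega> i * f i) - (\<Sum>i\<in>I. \<omega> i * g i)\<bar> \<le> C"
proof -
  have "\<bar>(\<Sum>i\<in>I. \<omega> i * f i) - (\<Sum>i\<in>I. \<omega> i * g i)\<bar> = \<bar>\<Sum>i\<in>I. \<omega> i * (f i - g i)\<bar>"
    by (simp add: sum_subtractf right_diff_distrib)
  also have "\<dots> \<le> (\<Sum>i\<in>I. \<omega> i * \<bar>f i - g i\<bar>)"
    by (intro order_trans[OF sum_abs] sum_mono) (simp add: abs_mult \<omega>_nonneg)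
  also have "\<dots> \<le> C" by (rule weighted_sum_le[OF assms])
  finally show ?thesis .
qed

lemma log_act_uniform_contraction:
  obtains \<tau> where "0 \<le> \<tau>" "\<tau> < 1"
    "\<And>i x y. i \<in> I \<Longrightarrow> \<bar>log_act (B i) x - log_act (B i) y\<bar> \<le> \<tau> * \<bar>x - y\<bar>"
proof -
  define t where "t = (\<lambda>A::real^2^2. \<bar>A$1$1 * A$2$2 - A$1$2 * A$2$1\<bar> / (A$1$1 * A$2$2 + A$1$2 * A$2$1))"
  \<comment> \<open>Each \<open>t (B i)\<close> has the form |u - v| / (u + v) with u, v > 0 and is
    therefore below 1; the inserted 0 provides \<open>0 \<le> \<tau>\<close>.\<close>
  define \<tau> where "\<tau> = Max (insert 0 ((\<lambda>i. t (B i)) ` I))"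
  have t: "t (B i) < 1" "\<bar>log_act (B i) x - log_act (B i) y\<bar> \<le> t (B i) * \<bar>x - y\<bar>" if "i \<in> I" for i x y
  proof -
    note p = positive_matrixD[OF pos_B[OF that]]
    have "B i $1$1 * B i $2$2 > 0" "B i $1$2 * B i $2$1 > 0" using p by simp_all
    then show "t (B i) < 1" by (simp add: t_def abs_less_iff)
    show "\<bar>log_act (B i) x - log_act (B i) y\<bar> \<le> t (B i) * \<bar>x - y\<bar>"
      unfolding log_act_def t_def by (intro log_ratio_lipschitz p)
  qed
  have "\<tau> < 1" "0 \<le> \<tau>" using t(1) finite_I by (auto simp: \<tau>_def)
  moreover have "\<bar>log_act (B i) x - log_act (B i) y\<bar> \<le> \<tau> * \<bar>x - y\<bar>" if "i \<in> I" for i x y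
  proof (rule order_trans[OF t(2)[OF that]])
    have "t (B i) \<le> \<tau>" using that finite_I by (auto simp: \<tau>_def)
    then show "t (B i) * \<bar>x - y\<bar> \<le> \<tau> * \<bar>x - y\<bar>" by (intro mult_right_mono) auto
  qed
  ultimately show thesis using that by blast
qed

lemma log_growth_lipschitz:
  assumes "i \<in> I"
  shows "\<bar>log_growth (B i) x - log_growth (B i) y\<bar> \<le> \<bar>x - y\<bar>"
proof -
  note p = positive_matrixD[OF pos_B[OF assms]]
  let ?p = "B i $1$1 + B i $1$2" and ?r = "B i $2$1 + B i $2$2"
  have pr: "?p > 0" "?r > 0" using p by simp_all
  \<comment> \<open>The subtracted term ln (exp \<theta> + 1) is the case q = s = 1 of
    \<open>log_ratio_lipschitz\<close>.\<close>
  have "\<bar>log_growth (B i) x - log_growth (B i) y\<bar> \<le> \<bar>?p * 1 - 1 * ?r\<bar> / (?p * 1 + 1 * ?r) * \<bar>x - y\<bar>"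
    using log_ratio_lipschitz[of ?p 1 ?r 1 x y] pr by (simp add: log_growth_def)
  also have "\<bar>?p * 1 - 1 * ?r\<bar> / (?p * 1 + 1 * ?r) \<le> 1"
    using pr by (subst divide_le_eq_1_pos) (auto simp: abs_le_iff)
  then have "\<bar>?p * 1 - 1 * ?r\<bar> / (?p * 1 + 1 * ?r) * \<bar>x - y\<bar> \<le> 1 * \<bar>x - y\<bar>"
    by (intro mult_right_mono) auto
  finally show ?thesis by simp
qed

text \<open>Averaging over contractions makes \<open>mean_growth k\<close> Lipschitz with constant
  \<open>\<tau> ^ k\<close>. One additional initial step moves the starting point 0 by at most a
  fixed \<open>D\<close>, so consecutive values at 0 differ by at most
  \<open>D * \<tau> ^ k\<close>, which is summable.\<close>

lemma mean_growth_convergent: "convergent (\<lambda>k. mean_growth k 0)"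
proof -
  obtain \<tau> where \<tau>: "0 \<le> \<tau>" "\<tau> < 1"
    "\<And>i x y. i \<in> I \<Longrightarrow> \<bar>log_act (B i) x - log_act (B i) y\<bar> \<le> \<tau> * \<bar>x - y\<bar>"
    using log_act_uniform_contraction by blast
  have lip: "\<bar>mean_growth k x - mean_growth k y\<bar> \<le> \<tau> ^ k * \<bar>x - y\<bar>" for k x y
  proof (induction k arbitrary: x y)
    case 0
    then show ?case unfolding mean_growth_simps by (simp add: weighted_diff_le log_growth_lipschitz)
  next
    case (Suc k)
    have "\<bar>mean_growth k (log_act (B i) x) - mean_growth k (log_act (B i) y)\<bar> \<le> \<tau> ^ k * (\<tau> * \<bar>x - y\<bar>)" if "i \<in> I" for i
      by (rule order_trans[OF Suc mult_left_mono]) (use \<tau> that in auto)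
    then show ?case unfolding mean_growth_simps by (intro weighted_diff_le) (simp add: mult_ac)
  qed
  define D where "D = (\<Sum>i\<in>I. \<bar>log_act (B i) 0\<bar>)"
  have D: "\<bar>log_act (B i) 0\<bar> \<le> D" if "i \<in> I" for i
    unfolding D_def using finite_I that by (intro member_le_sum) auto
  have step: "norm (mean_growth (Suc k) 0 - mean_growth k 0) \<le> D * \<tau> ^ k" for k
  proof -
    have "\<bar>(\<Sum>i\<in>I. \<omega> i * mean_growth k (log_act (B i) 0)) - (\<Sum>i\<in>I. \<omega> i * mean_growth k 0)\<bar> \<le> D * \<tau> ^ k"
    proof (rule weighted_diff_le)
      fix i assume i: "i \<in> I"
      have "\<bar>mean_growth k (log_act (B i) 0) - mean_growth k 0\<bar> \<le> \<tau> ^ k * \<bar>log_act (B i) 0\<bar>"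
        using lip[of k "log_act (B i) 0" 0] by simp
      also have "\<dots> \<le> \<tau> ^ k * D" using D[OF i] \<tau>(1) by (intro mult_left_mono) auto
      finally show "\<bar>mean_growth k (log_act (B i) 0) - mean_growth k 0\<bar> \<le> D * \<tau> ^ k" by (simp add: mult.commute)
    qed
    moreover have "(\<Sum>i\<in>I. \<omega> i * mean_growth k 0) = mean_growth k 0"
      by (simp add: \<omega>_sum flip: sum_distrib_right)
    ultimately show ?thesis by (simp add: mean_growth_simps)
  qed
  have "summable (\<lambda>k. D * \<tau> ^ k)" using \<tau> by (intro summable_mult summable_geometric) auto
  then have "summable (\<lambda>k. mean_growth (Suc k) 0 - mean_growth k 0)"
    by (rule summable_comparison_test'[where N = 0]) (use step in auto)
  then have "convergent (\<lambda>n. \<Sum>k<n. mean_growth (Suc k) 0 - mean_growth k 0)"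
    by (simp add: summable_iff_convergent)
  then have "convergent (\<lambda>n. mean_growth n 0 - mean_growth 0 0)"
    by (simp only: sum_lessThan_telescope[of "\<lambda>k. mean_growth k 0"])
  then show ?thesis by (simp add: convergent_diff_const_right_iff)
qed

definition growth_rate :: real where
  "growth_rate = lim (\<lambda>k. mean_growth k 0)"

lemma mean_growth_tendsto: "(\<lambda>k. mean_growth k 0) \<longlonglongrightarrow> growth_rate"
  using mean_growth_convergent by (simp add: growth_rate_def convergent_LIMSEQ_iff)

abbreviation T_iterate :: "nat \<Rightarrow> nat \<Rightarrow> complex" where
  "T_iterate k \<equiv> (inf_mat_apply (T_mat I B \<omega>) ^^ k) (bold_v I B \<omega>)"

lemma T_iterate_bounded: "\<exists>K. \<forall>n. norm (T_iterate k n) \<le> K"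
proof (induction k)
  case 0
  then show ?case using bold_v_eq(1)[where B = B, OF finite_I pos_B det_B] by simp
next
  case (Suc k)
  then obtain K where "\<And>n. norm (T_iterate k n) \<le> K" by blast
  then show ?case using T_mat_apply(2)[where B = B, OF finite_I pos_B \<omega>_sum, of "T_iterate k" K] by simp
qed

lemma T_iterate_summable: "summable (\<lambda>n. T_mat I B \<omega> j n * T_iterate k n)"
  using T_iterate_bounded[of k] T_mat_apply(1)[where B = B, OF finite_I pos_B \<omega>_sum] by blast

text \<open>The power series with coefficients \<open>T\<^sup>k v\<close> equals, up to an additive constant, the function
  whose value at \<open>z\<close> is the mean logarithmic growth in step \<open>k + 1\<close> of the random product started at \<open>z\<close>;
  the constants telescope.\<close>

lemma T_iterate_power_series:
  "(\<Sum>n. T_iterate k n * of_real (disc_coord \<theta>) ^ n) =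
     of_real (mean_growth k \<theta> - (if k = 0 then 0 else mean_growth (k - 1) 0))"
proof (induction k arbitrary: \<theta>)
  case 0
  have "(\<Sum>i\<in>I. \<omega> i * ln (F_mat (B i) $ 1 $ 2 * disc_coord \<theta> + F_mat (B i) $ 2 $ 2)) = mean_growth 0 \<theta>"
    unfolding mean_growth_simps by (intro sum.cong refl) (simp add: log_dual_denominator pos_B del: F_mat_nth)
  then show ?case
    using bold_v_eq(2)[where B = B and \<omega> = \<omega>, OF finite_I pos_B det_B disc_coord_bound[of \<theta>]] by simp
next
  case (Suc k)
  obtain K where K: "\<And>n. norm (T_iterate k n) \<le> K" using T_iterate_bounded by blast
  \<comment> \<open>\<open>c\<close> is the shift at level \<open>k\<close>. It passes through the
    average because the weights sum to 1, and subtracting \<open>T_iterate k 0\<close> cancels it,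
    leaving the shift \<open>mean_growth k 0\<close> at the next level.\<close>
  define c where "c = (if k = 0 then 0 else mean_growth (k - 1) 0)"
  have "(\<Sum>n. T_iterate (Suc k) n * of_real (disc_coord \<theta>) ^ n) =
      (\<Sum>i\<in>I. of_real (\<omega> i) * (\<Sum>n. T_iterate k n * dual_moebius (B i) (of_real (disc_coord \<theta>)) ^ n)) - T_iterate k 0"
    using T_mat_apply(3)[where B = B, OF finite_I pos_B \<omega>_sum K, of "of_real (disc_coord \<theta>)"] disc_coord_bound[of \<theta>] by simp
  also have "T_iterate k 0 = of_real (mean_growth k 0 - c)"
    using Suc[of 0] by (simp add: powser_zero c_def)
  also have "(\<Sum>i\<in>I. of_real (\<omega> i) * (\<Sum>n. T_iterate k n * dual_moebius (B i) (of_real (disc_coord \<theta>)) ^ n)) =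
      of_real (\<Sum>i\<in>I. \<omega> i * (mean_growth k (log_act (B i) \<theta>) - c))"
    unfolding of_real_sum of_real_mult
    by (intro sum.cong refl) (simp add: dual_moebius_disc_coord pos_B Suc c_def)
  also have "(\<Sum>i\<in>I. \<omega> i * (mean_growth k (log_act (B i) \<theta>) - c)) = mean_growth (Suc k) \<theta> - c"
    by (simp add: mean_growth_simps right_diff_distrib sum_subtractf \<omega>_sum flip: sum_distrib_right)
  finally show ?case by simp
qed

lemma T_iterate_0_sums: "(\<lambda>k. T_iterate k 0) sums of_real growth_rate"
proof -
  have eq: "T_iterate k 0 = of_real (mean_growth k 0 - (if k = 0 then 0 else mean_growth (k - 1) 0))" for k
    using T_iterate_power_series[of k 0] by (simp add: powser_zero)
  have "(\<Sum>k<Suc n. T_iterate k 0) = of_real (mean_growth n 0)" for n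
    unfolding eq by (induction n) auto
  then have "(\<lambda>n. \<Sum>k<Suc n. T_iterate k 0) \<longlonglongrightarrow> of_real growth_rate"
    by (simp only:) (intro tendsto_of_real mean_growth_tendsto)
  then show ?thesis
    unfolding sums_def by (subst (asm) filterlim_sequentially_Suc[where f = "\<lambda>n. \<Sum>k<n. T_iterate k 0"])
qed

definition transpose_act :: "'i \<Rightarrow> real \<times> real \<Rightarrow> real \<times> real" where
  "transpose_act i y = (B i $1$1 * fst y + B i $2$1 * snd y, B i $1$2 * fst y + B i $2$2 * snd y)"

text \<open>Along the transposed action \<open>log_growth\<close> is the increment of ln (fst y +
  snd y), while the direction moves by \<open>log_act\<close>; the sum of the expected increments
  therefore telescopes. This links \<open>growth_rate\<close> to expected logarithms of random
  products.\<close>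

lemma sum_mean_growth:
  assumes "fst y > 0" "snd y > 0"
  shows "(\<Sum>k<n. mean_growth k (ln (fst y / snd y))) =
    iterated_mean I \<omega> transpose_act n (\<lambda>y. ln (fst y + snd y)) y - ln (fst y + snd y)"
  using assms
proof (induction n arbitrary: y)
  case 0
  then show ?case by simp
next
  case (Suc n)
  let ?\<theta> = "ln (fst y / snd y)" and ?\<phi> = "\<lambda>y::real \<times> real. ln (fst y + snd y)"
  note y = Suc.prems
  have e: "exp ?\<theta> = fst y / snd y" using y by simp
  have 1: "fst (transpose_act i y) > 0" "snd (transpose_act i y) > 0"
    and 2: "log_act (B i) ?\<theta> = ln (fst (transpose_act i y) / snd (transpose_act i y))"
    and 3: "log_growth (B i) ?\<theta> = ?\<phi> (transpose_act i y) - ?\<phi> y" if "i \<in> I" for i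
  proof -
    note p = positive_matrixD[OF pos_B[OF that]]
    show f: "fst (transpose_act i y) > 0" "snd (transpose_act i y) > 0"
      using p y by (auto simp: transpose_act_def intro!: add_pos_pos)
    have "B i $1$1 * exp ?\<theta> + B i $2$1 = fst (transpose_act i y) / snd y"
      "B i $1$2 * exp ?\<theta> + B i $2$2 = snd (transpose_act i y) / snd y"
      unfolding e transpose_act_def using y by (auto simp: field_simps)
    then show "log_act (B i) ?\<theta> = ln (fst (transpose_act i y) / snd (transpose_act i y))"
      using f y unfolding log_act_def by (simp add: ln_divide_pos)
    have "(B i $1$1 + B i $1$2) * exp ?\<theta> + (B i $2$1 + B i $2$2) =
        (fst (transpose_act i y) + snd (transpose_act i y)) / snd y" "exp ?\<theta> + 1 = (fst y + snd y) / snd y"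
      unfolding e transpose_act_def using y by (auto simp: field_simps)
    then show "log_growth (B i) ?\<theta> = ?\<phi> (transpose_act i y) - ?\<phi> y"
      using f y unfolding log_growth_def by (simp add: ln_divide_pos add_pos_pos)
  qed
  have "(\<Sum>k<Suc n. mean_growth k ?\<theta>) =
      (\<Sum>i\<in>I. \<omega> i * (log_growth (B i) ?\<theta> + (\<Sum>k<n. mean_growth k (log_act (B i) ?\<theta>))))"
    unfolding sum.lessThan_Suc_shift mean_growth_simps
    by (simp add: distrib_left sum.distrib sum_distrib_left sum.swap[of _ _ "{..<n}"])
  also have "\<dots> = (\<Sum>i\<in>I. \<omega> i * (iterated_mean I \<omega> transpose_act n ?\<phi> (transpose_act i y) - ?\<phi> y))"
    by (intro sum.cong refl) (simp add: 1 2 3 Suc.IH)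
  also have "\<dots> = iterated_mean I \<omega> transpose_act (Suc n) ?\<phi> y - ?\<phi> y"
    by (simp add: right_diff_distrib sum_subtractf \<omega>_sum flip: sum_distrib_right)
  finally show ?case .
qed

end

section \<open>Strong law of large numbers for blocks\<close>

text \<open>Hoeffding's inequality bounds the probability that the n-th sum deviates from its mean
  by at least n \<epsilon> by 2 r^n with r < 1. By Borel-Cantelli such deviations almost surely
  occur only finitely often, and the countably many values \<epsilon> = 1 / (k + 1) suffice.\<close>

lemma (in prob_space) bounded_strong_law:
  fixes X :: "nat \<Rightarrow> 'a \<Rightarrow> real"
  assumes indep: "indep_vars (\<lambda>_. borel) X UNIV"
    and bound: "\<And>j \<xi>. \<xi> \<in> space M \<Longrightarrow> \<bar>X j \<xi>\<bar> \<le> C"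
    and mean: "\<And>j. expectation (X j) = \<mu>"
  shows "AE \<xi> in M. (\<lambda>n. (\<Sum>j<n. X j \<xi>) / real n) \<longlonglongrightarrow> \<mu>"
proof -
  \<comment> \<open>The summand 1 keeps \<open>c\<close> positive, so the denominator in Hoeffding's
    exponent is nonzero for \<open>n \<ge> 1\<close>.\<close>
  define c where "c = \<bar>C\<bar> + 1"
  have c: "c > 0" by (simp add: c_def)
  have [measurable]: "X j \<in> borel_measurable M" for j
    using indep by (auto simp: indep_vars_def)
  define A where "A = (\<lambda>\<epsilon> n. {\<xi> \<in> space M. \<bar>(\<Sum>j<n. X j \<xi>) - n * \<mu>\<bar> \<ge> n * \<epsilon>})"
  have AE_eps: "AE \<xi> in M. eventually (\<lambda>n. \<xi> \<in> space M - A \<epsilon> n) sequentially" if \<epsilon>: "\<epsilon> > 0" for \<epsilon>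
  proof (rule borel_cantelli_AE1)
    show "A \<epsilon> n \<in> sets M" for n
      unfolding A_def by measurable
    show "emeasure M (A \<epsilon> n) < \<infinity>" for n
      by (simp add: emeasure_eq_measure)
    define r where "r = exp (- (\<epsilon>\<^sup>2 / (2 * c\<^sup>2)))"
    have r: "0 < r" "r < 1" using \<epsilon> c by (auto simp: r_def)
    have "prob (A \<epsilon> n) \<le> 2 * r ^ n" if "n \<ge> 1" for n
    proof -
      interpret Hoeffding_ineq M "{..<n}" X "\<lambda>_. - c" "\<lambda>_. c" "\<Sum>i<n. expectation (X i)"
      proof unfold_locales
        show "indep_vars (\<lambda>_. borel) X {..<n}"
          by (rule indep_vars_subset[OF indep]) auto
        show "AE x in M. X i x \<in> {- c..c}" if "i \<in> {..<n}" for i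
          using bound[of _ i] by (intro AE_I2) (fastforce simp: c_def)
      qed auto
      have s: "(\<Sum>i<n. (c - - c)\<^sup>2) = real n * (2 * c)\<^sup>2" by simp
      have "prob (A \<epsilon> n) \<le> 2 * exp (- 2 * (real n * \<epsilon>)\<^sup>2 / (real n * (2 * c)\<^sup>2))"
        unfolding A_def s[symmetric] using Hoeffding_ineq_abs_ge[of "real n * \<epsilon>"] \<epsilon> c that
        by (simp add: mean)
      also have "- 2 * (real n * \<epsilon>)\<^sup>2 / (real n * (2 * c)\<^sup>2) = real n * (- (\<epsilon>\<^sup>2 / (2 * c\<^sup>2)))"
        using that c by (simp add: power2_eq_square field_simps)
      also have "exp \<dots> = r ^ n" by (simp only: r_def exp_of_nat_mult)
      finally show ?thesis .
    qed
    moreover have "summable (\<lambda>n. 2 * r ^ n)"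
      using r by (intro summable_mult summable_geometric) auto
    ultimately show "summable (\<lambda>n. prob (A \<epsilon> n))"
      by (auto intro: summable_comparison_test'[where N = 1 and g = "\<lambda>n. 2 * r ^ n"])
  qed
  have "AE \<xi> in M. \<forall>k. eventually (\<lambda>n. \<xi> \<in> space M - A (inverse (Suc k)) n) sequentially"
    by (subst AE_all_countable) (intro allI AE_eps, simp)
  then show ?thesis
  proof (rule AE_mp, intro AE_I2 impI)
    fix \<xi> assume \<xi>: "\<xi> \<in> space M" and *: "\<forall>k. eventually (\<lambda>n. \<xi> \<in> space M - A (inverse (Suc k)) n) sequentially"
    show "(\<lambda>n. (\<Sum>j<n. X j \<xi>) / real n) \<longlonglongrightarrow> \<mu>"
    proof (rule tendstoI)
      fix e :: real assume "e > 0"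
      then obtain k where k: "inverse (real (Suc k)) < e" using reals_Archimedean by blast
      from *[rule_format, of k] eventually_gt_at_top[of 0]
      show "eventually (\<lambda>n. dist ((\<Sum>j<n. X j \<xi>) / real n) \<mu> < e) sequentially"
      proof eventually_elim
        case (elim n)
        then have "\<bar>(\<Sum>j<n. X j \<xi>) - n * \<mu>\<bar> < n * inverse (Suc k)"
          using \<xi> by (auto simp: A_def)
        also have "\<dots> < n * e" using k elim by (intro mult_strict_left_mono) auto
        finally have "\<bar>(\<Sum>j<n. X j \<xi>) - n * \<mu>\<bar> / n < e"
          using elim by (simp add: divide_simps mult.commute)
        moreover have "(\<Sum>j<n. X j \<xi>) / n - \<mu> = ((\<Sum>j<n. X j \<xi>) - n * \<mu>) / n"
          using elim by (simp add: field_simps)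
        ultimately show ?case by (simp add: dist_real_def)
      qed
    qed
  qed
qed

text \<open>Disjoint groups of independent variables are independent. Over a finite alphabet the
  product space of a block is discrete, so every \<open>f\<close> is measurable on it.\<close>

lemma (in prob_space) indep_vars_blocks:
  fixes X :: "nat \<Rightarrow> 'a \<Rightarrow> 'b" and f :: "'b list \<Rightarrow> real"
  assumes indep: "indep_vars (\<lambda>_. count_space A) X {s..}" and A: "finite A"
  shows "indep_vars (\<lambda>_. borel) (\<lambda>j \<xi>. f (map (\<lambda>i. X i \<xi>) [s + j * N..<s + j * N + N])) UNIV"
proof -
  define K where "K = (\<lambda>j. {s + j * N..<s + j * N + N})"
  have disj: "disjoint_family K"
  proof (unfold disjoint_family_on_def, intro ballI impI)
    fix j k :: nat assume "j \<noteq> k"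
    have "K j \<inter> K k = {}" if "j < k" for j k
    proof -
      have "(j + 1) * N \<le> k * N" using that by (intro mult_le_mono1) auto
      then show ?thesis by (auto simp: K_def)
    qed
    then show "K j \<inter> K k = {}" using \<open>j \<noteq> k\<close> by (metis Int_commute linorder_neqE_nat)
  qed
  have "indep_vars (\<lambda>j. PiM (K j) (\<lambda>_. count_space A)) (\<lambda>j \<xi>. restrict (\<lambda>i. X i \<xi>) (K j)) UNIV"
    by (rule indep_vars_restrict[OF indep _ disj]) (auto simp: K_def)
  then have "indep_vars (\<lambda>_. borel)
      (\<lambda>j \<xi>. f (map (restrict (\<lambda>i. X i \<xi>) (K j)) [s + j * N..<s + j * N + N])) UNIV"
  proof (rule indep_vars_compose2)
    fix j
    have "PiM (K j) (\<lambda>_. count_space A) = count_space (PiE (K j) (\<lambda>_. A))"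
      using A by (intro count_space_PiM_finite) (auto simp: K_def countable_finite)
    then show "(\<lambda>g. f (map g [s + j * N..<s + j * N + N])) \<in> PiM (K j) (\<lambda>_. count_space A) \<rightarrow>\<^sub>M borel"
      by simp
  qed
  moreover have "map (restrict (\<lambda>i. X i \<xi>) (K j)) [s + j * N..<s + j * N + N] =
      map (\<lambda>i. X i \<xi>) [s + j * N..<s + j * N + N]" for j \<xi>
    by (auto simp: K_def)
  ultimately show ?thesis by simp
qed

text \<open>The sample space splits into the finitely many events on which the block spells a given
  word, and independence makes their probabilities products of letter weights.\<close>

lemma (in prob_space) expectation_block:
  fixes X :: "nat \<Rightarrow> 'a \<Rightarrow> 'b" and f :: "'b list \<Rightarrow> real"
  assumes indep: "indep_vars (\<lambda>_. count_space A) X {s..}" and A: "finite A"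
    and law: "\<And>n i. n \<ge> s \<Longrightarrow> i \<in> A \<Longrightarrow> prob {\<xi> \<in> space M. X n \<xi> = i} = w i"
    and t: "t \<ge> s"
  shows "expectation (\<lambda>\<xi>. f (map (\<lambda>i. X i \<xi>) [t..<t + N])) =
    (\<Sum>xs | set xs \<subseteq> A \<and> length xs = N. prod_list (map w xs) * f xs)"
proof -
  let ?L = "{xs. set xs \<subseteq> A \<and> length xs = N}"
  let ?l = "\<lambda>\<xi>. map (\<lambda>i. X i \<xi>) [t..<t + N]"
  define E where "E = (\<lambda>xs. {\<xi> \<in> space M. ?l \<xi> = xs})"
  have L: "finite ?L" using A by (simp add: finite_lists_length_eq)
  have rv: "X n \<in> M \<rightarrow>\<^sub>M count_space A" if "n \<ge> s" for n
    using indep that by (auto simp: indep_vars_def)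
  have XA: "X n \<xi> \<in> A" if "n \<ge> s" "\<xi> \<in> space M" for n \<xi>
    using measurable_space[OF rv[OF that(1)] that(2)] by simp
  have E_eq: "E xs = space M \<inter> (\<Inter>i\<in>{t..<t + N}. X i -` {xs ! (i - t)} \<inter> space M)" if "xs \<in> ?L" for xs
  proof -
    have "?l \<xi> = xs \<longleftrightarrow> (\<forall>i\<in>{t..<t + N}. X i \<xi> = xs ! (i - t))" for \<xi>
    proof -
      have "?l \<xi> = xs \<longleftrightarrow> (\<forall>k<N. X (t + k) \<xi> = xs ! k)"
        using that by (auto simp: list_eq_iff_nth_eq)
      also have "\<dots> \<longleftrightarrow> (\<forall>i\<in>{t..<t + N}. X i \<xi> = xs ! (i - t))"
      proof safe
        fix i assume *: "\<forall>k<N. X (t + k) \<xi> = xs ! k" and i: "i \<in> {t..<t + N}"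
        show "X i \<xi> = xs ! (i - t)" using *[rule_format, of "i - t"] i by auto
      next
        fix k assume *: "\<forall>i\<in>{t..<t + N}. X i \<xi> = xs ! (i - t)" and k: "k < N"
        show "X (t + k) \<xi> = xs ! k" using *[rule_format, of "t + k"] k by auto
      qed
      finally show ?thesis .
    qed
    then show ?thesis by (auto simp: E_def)
  qed
  have Xsets: "X i -` {a} \<inter> space M \<in> events" if "i \<ge> s" "a \<in> A" for i a
    using measurable_sets[OF rv[OF that(1)], of "{a}"] that by simp
  have nthA: "xs ! (i - t) \<in> A" if "xs \<in> ?L" "i \<in> {t..<t + N}" for xs i
  proof -
    have "i - t < length xs" using that by auto
    then show ?thesis using that(1) nth_mem by blast
  qed
  have E_sets: "E xs \<in> events" if "xs \<in> ?L" for xs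
  \<comment> \<open>For an empty block the intersection over no indices is \<open>UNIV\<close>; only
    the factor \<open>space M\<close> in \<open>E_eq\<close> remains.\<close>
  proof (cases "N = 0")
    case False
    have "(\<Inter>i\<in>{t..<t + N}. X i -` {xs ! (i - t)} \<inter> space M) \<in> events"
      using False t by (intro sets.finite_INT Xsets nthA[OF that]) auto
    then show ?thesis unfolding E_eq[OF that] by simp
  qed (use E_eq[OF that] in simp)
  have E_prob: "prob (E xs) = prod_list (map w xs)" if "xs \<in> ?L" for xs
  proof (cases "N = 0")
    case True
    then show ?thesis using that by (simp add: E_def prob_space)
  next
    case False
    have "E xs = (\<Inter>i\<in>{t..<t + N}. X i -` {xs ! (i - t)} \<inter> space M)"
      using E_eq[OF that] False by auto
    also have "prob \<dots> = (\<Prod>i\<in>{t..<t + N}. prob (X i -` {xs ! (i - t)} \<inter> space M))"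
      using False t nthA[OF that] by (intro indep_varsD[OF indep]) auto
    also have "\<dots> = (\<Prod>i\<in>{t..<t + N}. w (xs ! (i - t)))"
    proof (intro prod.cong refl)
      fix i assume i: "i \<in> {t..<t + N}"
      have "X i -` {xs ! (i - t)} \<inter> space M = {\<xi> \<in> space M. X i \<xi> = xs ! (i - t)}" by auto
      then show "prob (X i -` {xs ! (i - t)} \<inter> space M) = w (xs ! (i - t))"
        using law[OF _ nthA[OF that i]] i t by simp
    qed
    also have "\<dots> = (\<Prod>k\<in>{0..<N}. w (xs ! k))"
      by (rule prod.reindex_bij_witness[of _ "\<lambda>k. k + t" "\<lambda>i. i - t"]) auto
    also have "\<dots> = prod_list (map w xs)"
      using that by (simp add: prod.list_conv_set_nth)
    finally show ?thesis .
  qed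
  have "expectation (\<lambda>\<xi>. f (?l \<xi>)) = expectation (\<lambda>\<xi>. \<Sum>xs\<in>?L. f xs * indicator (E xs) \<xi>)"
  proof (rule Bochner_Integration.integral_cong[OF refl])
    fix \<xi> assume \<xi>: "\<xi> \<in> space M"
    have mem: "?l \<xi> \<in> ?L" using XA \<xi> t by auto
    have "(\<Sum>xs\<in>?L. f xs * indicator (E xs) \<xi>) = (\<Sum>xs\<in>?L. if xs = ?l \<xi> then f xs else 0)"
      using \<xi> by (intro sum.cong refl) (auto simp: E_def indicator_def)
    also have "\<dots> = f (?l \<xi>)"
      using L mem by simp
    finally show "f (?l \<xi>) = (\<Sum>xs\<in>?L. f xs * indicator (E xs) \<xi>)" by simp
  qed
  also have "\<dots> = (\<Sum>xs\<in>?L. expectation (\<lambda>\<xi>. f xs * indicator (E xs) \<xi>))"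
    by (intro Bochner_Integration.integral_sum integrable_mult_right integrable_real_indicator E_sets)
       (simp_all add: emeasure_eq_measure)
  also have "\<dots> = (\<Sum>xs\<in>?L. prod_list (map w xs) * f xs)"
    using E_sets E_prob by (intro sum.cong refl) simp
  finally show ?thesis .
qed

lemma (in prob_space) strong_law_blocks:
  fixes X :: "nat \<Rightarrow> 'a \<Rightarrow> 'b" and f :: "'b list \<Rightarrow> real"
  assumes indep: "indep_vars (\<lambda>_. count_space A) X {s..}" and A: "finite A"
    and law: "\<And>n i. n \<ge> s \<Longrightarrow> i \<in> A \<Longrightarrow> prob {\<xi> \<in> space M. X n \<xi> = i} = w i"
  shows "AE \<xi> in M. (\<lambda>n. (\<Sum>j<n. f (map (\<lambda>i. X i \<xi>) [s + j * N..<s + j * N + N])) / real n)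
    \<longlonglongrightarrow> (\<Sum>xs | set xs \<subseteq> A \<and> length xs = N. prod_list (map w xs) * f xs)"
proof (rule bounded_strong_law)
  show "indep_vars (\<lambda>_. borel) (\<lambda>j \<xi>. f (map (\<lambda>i. X i \<xi>) [s + j * N..<s + j * N + N])) UNIV"
    by (rule indep_vars_blocks[OF indep A])
  show "expectation (\<lambda>\<xi>. f (map (\<lambda>i. X i \<xi>) [s + j * N..<s + j * N + N])) =
      (\<Sum>xs | set xs \<subseteq> A \<and> length xs = N. prod_list (map w xs) * f xs)" for j
    by (rule expectation_block[OF indep A law]) auto
  fix j \<xi> assume \<xi>: "\<xi> \<in> space M"
  have "X n \<xi> \<in> A" if "n \<ge> s" for n
    using indep \<xi> that by (auto simp: indep_vars_def dest!: measurable_space)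
  then have "map (\<lambda>i. X i \<xi>) [s + j * N..<s + j * N + N] \<in> {xs. set xs \<subseteq> A \<and> length xs = N}"
    by auto
  then show "\<bar>f (map (\<lambda>i. X i \<xi>) [s + j * N..<s + j * N + N])\<bar> \<le> (\<Sum>xs | set xs \<subseteq> A \<and> length xs = N. \<bar>f xs\<bar>)"
    using A by (intro member_le_sum) (auto simp: finite_lists_length_eq)
qed

section \<open>Random linear recurrences\<close>

lemma tendsto_arithmetic_means:
  fixes g :: "nat \<Rightarrow> real"
  assumes g: "g \<longlonglongrightarrow> l"
  shows "(\<lambda>n. (\<Sum>k<n. g k) / real n) \<longlonglongrightarrow> l"
proof (rule tendstoI)
  fix e :: real assume e: "e > 0"
  then obtain N where N: "\<And>k. k \<ge> N \<Longrightarrow> \<bar>g k - l\<bar> < e / 2"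
    using LIMSEQ_D[OF g, of "e / 2"] by (auto simp: real_norm_def)
  define C where "C = (\<Sum>k<N. \<bar>g k - l\<bar>)"
  have bd: "\<bar>(\<Sum>k<n. g k) - n * l\<bar> \<le> C + n * (e / 2)" for n
  proof -
    have "\<bar>(\<Sum>k<n. g k) - n * l\<bar> = \<bar>\<Sum>k<n. g k - l\<bar>"
      by (simp add: sum_subtractf)
    also have "\<dots> \<le> (\<Sum>k<n. (if k < N then \<bar>g k - l\<bar> else 0) + e / 2)"
      by (intro order_trans[OF sum_abs] sum_mono) (use N e in \<open>auto simp: not_less less_imp_le\<close>)
    also have "\<dots> = (\<Sum>k\<in>{..<n} \<inter> {..<N}. \<bar>g k - l\<bar>) + n * (e / 2)"
      by (simp add: sum.distrib sum.inter_restrict lessThan_def)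
    also have "(\<Sum>k\<in>{..<n} \<inter> {..<N}. \<bar>g k - l\<bar>) \<le> C"
      unfolding C_def by (intro sum_mono2) auto
    finally show ?thesis by simp
  qed
  have "eventually (\<lambda>n. real n > 2 * C / e) sequentially"
    using filterlim_real_sequentially by (simp add: filterlim_at_top_dense)
  then show "eventually (\<lambda>n. dist ((\<Sum>k<n. g k) / real n) l < e) sequentially"
    using eventually_gt_at_top[of 0]
  proof eventually_elim
    case (elim n)
    then have "C < n * (e / 2)" using e by (simp add: field_simps)
    then have "\<bar>(\<Sum>k<n. g k) - n * l\<bar> < n * e" using bd[of n] by simp
    then have "\<bar>(\<Sum>k<n. g k) - n * l\<bar> / n < e"
      using elim by (simp add: divide_simps mult.commute)
    moreover have "(\<Sum>k<n. g k) / n - l = ((\<Sum>k<n. g k) - n * l) / n"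
      using elim by (simp add: field_simps)
    ultimately show ?case by (simp add: dist_real_def)
  qed
qed

text \<open>Up to time \<open>n\<close> there are about n / p complete blocks, each costing an error
  \<open>D\<close>, and fewer than \<open>p\<close> leftover steps, each also costing at most
  \<open>D\<close>. After division by \<open>n\<close> the first contribution is at most D / p and
  the second tends to 0.\<close>

lemma block_approximation:
  fixes y S :: "nat \<Rightarrow> real"
  assumes p: "p \<ge> 1" and D: "D \<ge> 0"
    and lip: "\<And>n. n \<ge> 1 \<Longrightarrow> \<bar>y (Suc n) - y n\<bar> \<le> D"
    and blocks: "\<And>j. \<bar>y (1 + p * j) - S j\<bar> \<le> real j * D"
    and lim: "(\<lambda>j. S j / real j) \<longlonglongrightarrow> A" and e: "e > 0"
  shows "eventually (\<lambda>n. \<bar>y n / real n - A / real p\<bar> \<le> D / real p + e) sequentially"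
proof -
  \<comment> \<open>The number of complete blocks; the blocks start at time 1, hence
    \<open>n - 1\<close>.\<close>
  define J where "J = (\<lambda>n. (n - 1) div p)"
  have J: "n = 1 + p * J n + (n - 1) mod p" if "n \<ge> 1" for n
    using that by (simp add: J_def)
  have bd: "\<bar>y n - S (J n)\<bar> \<le> real (J n) * D + real p * D" if "n \<ge> 1" for n
  proof -
    have step: "\<bar>y (1 + p * J n + r) - y (1 + p * J n)\<bar> \<le> real r * D" for r
    proof (induction r)
      case (Suc r)
      then show ?case using lip[of "1 + p * J n + r"] by (simp add: algebra_simps)
    qed simp
    have "\<bar>y n - y (1 + p * J n)\<bar> \<le> real ((n - 1) mod p) * D"
      using step[of "(n - 1) mod p"] J[OF that] by simp
    also have "\<dots> \<le> real p * D"
      using p D by (intro mult_right_mono) (auto intro: less_imp_le)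
    finally show ?thesis using blocks[of "J n"] by linarith
  qed
  have Jp: "real p * real (J n) \<le> real n" if "n \<ge> 1" for n
    using J[OF that] by (metis le_add1 le_add2 le_trans of_nat_le_iff of_nat_mult)
  have J_lim: "filterlim J at_top sequentially"
  proof (rule filterlim_at_top[THEN iffD2], intro allI)
    fix Z
    show "eventually (\<lambda>n. Z \<le> J n) sequentially"
      using eventually_ge_at_top[of "1 + p * Z"]
    proof eventually_elim
      case (elim n)
      then have "p * Z \<le> n - 1" by simp
      then have "p * Z div p \<le> J n" unfolding J_def by (rule div_le_mono)
      then show ?case using p by simp
    qed
  qed
  have quot: "(\<lambda>n. real (J n) / real n) \<longlonglongrightarrow> 1 / real p"
  proof (rule tendsto_sandwich)
    \<comment> \<open>The 2 absorbs the initial offset and the incomplete block: \<open>n\<close> is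
      at most p (J n + 2).\<close>
    show "eventually (\<lambda>n. 1 / real p - 2 / real n \<le> real (J n) / real n) sequentially"
      using eventually_ge_at_top[of 1]
    proof eventually_elim
      case (elim n)
      have "(n - 1) mod p < p" using p by simp
      then have "real n \<le> 1 + real p * real (J n) + real p"
        using J[OF elim] by (metis add_left_mono less_imp_le of_nat_1 of_nat_add of_nat_le_iff of_nat_mult)
      moreover have "1 \<le> real p" using p by simp
      ultimately have "real n \<le> real p * (real (J n) + 2)" by (simp add: algebra_simps)
      then have "real n / real p \<le> real (J n) + 2"
        using p by (simp add: divide_le_eq mult.commute)
      then have "(real n / real p - 2) / real n \<le> real (J n) / real n"
        by (intro divide_right_mono) auto
      then show ?case using elim by (simp add: diff_divide_distrib)
    qed
    show "eventually (\<lambda>n. real (J n) / real n \<le> 1 / real p) sequentially"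
      using eventually_ge_at_top[of 1]
    proof eventually_elim
      case (elim n)
      show ?case using Jp[OF elim] elim p by (simp add: divide_simps mult.commute)
    qed
    have "(\<lambda>n. 1 / real p - 2 / real n) \<longlonglongrightarrow> 1 / real p - 0"
      by (intro tendsto_intros lim_const_over_n)
    then show "(\<lambda>n. 1 / real p - 2 / real n) \<longlonglongrightarrow> 1 / real p" by simp
  qed auto
  have "(\<lambda>n. S (J n) / real (J n) * (real (J n) / real n)) \<longlonglongrightarrow> A * (1 / real p)"
    by (intro tendsto_mult quot filterlim_compose[OF lim J_lim])
  moreover have "eventually (\<lambda>n. S (J n) / real (J n) * (real (J n) / real n) = S (J n) / real n) sequentially"
    using filterlim_at_top[THEN iffD1, OF J_lim, rule_format, of 1] by eventually_elim simp
  ultimately have "(\<lambda>n. S (J n) / real n) \<longlonglongrightarrow> A * (1 / real p)"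
    by (rule Lim_transform_eventually)
  then have "(\<lambda>n. S (J n) / real n) \<longlonglongrightarrow> A / real p"
    by simp
  then have "eventually (\<lambda>n. \<bar>S (J n) / real n - A / real p\<bar> < e / 2) sequentially"
    using e by (auto dest!: tendstoD[of _ _ _ "e / 2"] simp: dist_real_def)
  moreover have "eventually (\<lambda>n. real p * D / real n < e / 2) sequentially"
    using e by (intro order_tendstoD(2)[OF lim_const_over_n]) simp
  ultimately show ?thesis
    using eventually_ge_at_top[of 1]
  proof eventually_elim
    case (elim n)
    have "\<bar>y n / real n - S (J n) / real n\<bar> = \<bar>y n - S (J n)\<bar> / real n"
      by (simp add: abs_divide flip: diff_divide_distrib)
    also have "\<dots> \<le> (real (J n) * D + real p * D) / real n"
      using bd elim by (intro divide_right_mono) auto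
    also have "\<dots> = real (J n) / real n * D + real p * D / real n"
      by (simp add: add_divide_distrib)
    also have "real (J n) / real n * D \<le> 1 / real p * D"
      using Jp[of n] elim p D by (intro mult_right_mono) (simp_all add: field_simps)
    finally have "\<bar>y n / real n - S (J n) / real n\<bar> \<le> D / real p + real p * D / real n"
      by simp
    then show ?case using elim by linarith
  qed
qed

text \<open>First a block length p = c L is fixed that makes both the error of the mean rate and D /
  p small, then n tends to infinity. The factor \<open>c\<close> allows for mean rates known only
  along multiples of \<open>c\<close>; below it is 2, because of the pairs.\<close>

lemma tendsto_of_block_approximations:
  fixes y :: "nat \<Rightarrow> real" and S :: "nat \<Rightarrow> nat \<Rightarrow> real"
  assumes D: "D \<ge> 0"
    and lip: "\<And>n. n \<ge> 1 \<Longrightarrow> \<bar>y (Suc n) - y n\<bar> \<le> D"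
    and blocks: "\<And>p j. p \<ge> 1 \<Longrightarrow> \<bar>y (1 + p * j) - S p j\<bar> \<le> real j * D"
    and lim: "\<And>p. p \<ge> 1 \<Longrightarrow> (\<lambda>j. S p j / real j) \<longlonglongrightarrow> A p"
    and A: "(\<lambda>L. A (c * L) / real (c * L)) \<longlonglongrightarrow> l" and c: "c \<ge> 1"
  shows "(\<lambda>n. y n / real n) \<longlonglongrightarrow> l"
proof (rule tendstoI)
  fix e :: real assume e: "e > 0"
  have "eventually (\<lambda>L. \<bar>A (c * L) / real (c * L) - l\<bar> < e / 4) sequentially"
    using tendstoD[OF A, of "e / 4"] e by (simp add: dist_real_def)
  moreover have "eventually (\<lambda>L. D / real L < e / 4) sequentially"
    using e by (intro order_tendstoD(2)[OF lim_const_over_n]) simp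
  ultimately have "eventually (\<lambda>L. \<bar>A (c * L) / real (c * L) - l\<bar> < e / 4 \<and> D / real L < e / 4 \<and> L \<ge> 1) sequentially"
    using eventually_ge_at_top[of 1] by eventually_elim blast
  then obtain L where L: "\<bar>A (c * L) / real (c * L) - l\<bar> < e / 4" "D / real L < e / 4" "L \<ge> 1"
    by (auto dest: eventually_happens)
  define p where "p = c * L"
  have p: "p \<ge> 1" "L \<le> p" using L(3) c by (auto simp: p_def)
  have "D / real p \<le> D / real L"
    using p L(3) D by (intro divide_left_mono) auto
  with L(2) have Dp: "D / real p < e / 4" by linarith
  have "eventually (\<lambda>n. \<bar>y n / real n - A p / real p\<bar> \<le> D / real p + e / 4) sequentially"
    using e p by (intro block_approximation[OF p(1) D lip blocks lim]) auto
  then show "eventually (\<lambda>n. dist (y n / real n) l < e) sequentially"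
  proof eventually_elim
    case (elim n)
    with L(1) Dp e show ?case unfolding dist_real_def p_def by linarith
  qed
qed

section \<open>The recurrence on pairs of consecutive terms and its invariant cone\<close>

text \<open>The state holds two consecutive terms of the sequence, the older one first; a step
  multiplies this column vector by the companion matrix M_i.\<close>

definition rec_step :: "(nat \<Rightarrow> real) \<Rightarrow> (nat \<Rightarrow> real) \<Rightarrow> nat \<Rightarrow> real \<times> real \<Rightarrow> real \<times> real" where
  "rec_step a b i y = (snd y, b i * fst y + a i * snd y)"

definition rec_run :: "(nat \<Rightarrow> real) \<Rightarrow> (nat \<Rightarrow> real) \<Rightarrow> real \<times> real \<Rightarrow> nat list \<Rightarrow> real \<times> real" where
  "rec_run a b = foldl (\<lambda>y i. rec_step a b i y)"

lemma rec_run_simps [simp]: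
  "rec_run a b y [] = y"
  "rec_run a b y (i # xs) = rec_run a b (rec_step a b i y) xs"
  "rec_run a b y (xs @ ys) = rec_run a b (rec_run a b y xs) ys"
  by (simp_all add: rec_run_def)

lemma rec_run_scale:
  "rec_run a b (c * u, c * v) xs = (c * fst (rec_run a b (u, v) xs), c * snd (rec_run a b (u, v) xs))"
proof (induction xs arbitrary: u v)
  case (Cons i xs)
  have "rec_step a b i (c * u, c * v) = (c * v, c * (b i * u + a i * v))"
    by (simp add: rec_step_def algebra_simps)
  then show ?case by (simp add: Cons rec_step_def)
qed simp

text \<open>Multiplication by the transposed companion matrix.\<close>

definition dual_step :: "(nat \<Rightarrow> real) \<Rightarrow> (nat \<Rightarrow> real) \<Rightarrow> nat \<Rightarrow> real \<times> real \<Rightarrow> real \<times> real" where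
  "dual_step a b i y = (b i * snd y, fst y + a i * snd y)"

text \<open>Moving the transposed steps one by one across the scalar product turns them into steps
  of the recurrence, in reversed order.\<close>

lemma foldl_dual_step:
  "fst (foldl (\<lambda>y i. dual_step a b i y) y xs) * fst z + snd (foldl (\<lambda>y i. dual_step a b i y) y xs) * snd z =
   fst y * fst (rec_run a b z (rev xs)) + snd y * snd (rec_run a b z (rev xs))"
  by (induction xs arbitrary: y) (simp_all add: rec_step_def dual_step_def algebra_simps)

locale bounded_coeffs =
  fixes A :: "nat set" and a b :: "nat \<Rightarrow> real" and lo hi :: real
  assumes lo: "0 < lo" "lo \<le> 1"
    and a_lo: "\<And>i. i \<in> A \<Longrightarrow> lo \<le> a i" and a_hi: "\<And>i. i \<in> A \<Longrightarrow> a i \<le> hi"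
    and b_pos: "\<And>i. i \<in> A \<Longrightarrow> 0 < b i" and b_hi: "\<And>i. i \<in> A \<Longrightarrow> b i \<le> hi"
    and hi: "hi \<ge> 0"
begin

text \<open>Chosen to make the cone \<open>tame\<close> invariant: if fst y is at most snd y / lo,
  the next term is at most (hi + hi / lo) snd y. The summand 1 gives \<open>K \<ge> 1\<close>, so
  that \<open>(1, 1)\<close> is tame.\<close>

definition K :: real where "K = 1 + hi + hi / lo"

text \<open>All three summands are nonnegative, so a single constant serves for the errors of one
  step, of a restart at \<open>(1, 1)\<close>, and of replacing the sum of the coordinates by the
  second one.\<close>

definition D :: real where "D = ln K - ln lo + ln (1 + 1 / lo)"

lemma K: "K \<ge> 1"
  using lo hi by (simp add: K_def)

lemma D_bounds: "ln K \<le> D" "- ln lo \<le> D" "ln (1 + 1 / lo) \<le> D" "0 \<le> D"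
proof -
  have "ln K \<ge> 0" "ln lo \<le> 0" "ln (1 + 1 / lo) \<ge> 0" using K lo by auto
  then show "ln K \<le> D" "- ln lo \<le> D" "ln (1 + 1 / lo) \<le> D" "0 \<le> D"
    by (auto simp: D_def)
qed

definition tame :: "real \<times> real \<Rightarrow> bool" where
  "tame y \<longleftrightarrow> 0 < fst y \<and> lo * fst y \<le> snd y \<and> snd y \<le> K * fst y"

lemma tame_snd_pos: "tame y \<Longrightarrow> 0 < snd y"
  using lo mult_pos_pos[of lo "fst y"] unfolding tame_def by linarith

lemma tame_one: "tame (1, 1)"
  using lo K by (simp add: tame_def)

lemma tame_step:
  assumes y: "tame y" and i: "i \<in> A"
  shows "tame (rec_step a b i y)"
proof -
  note v = tame_snd_pos[OF y]
  have u: "0 < fst y" "fst y \<le> snd y / lo" using y lo by (auto simp: tame_def field_simps)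
  have "lo * snd y \<le> a i * snd y" using a_lo[OF i] v by (intro mult_right_mono) auto
  moreover have "0 \<le> b i * fst y" using b_pos[OF i] u by simp
  moreover have "a i * snd y \<le> hi * snd y" using a_hi[OF i] v by (intro mult_right_mono) auto
  moreover have "b i * fst y \<le> hi * (snd y / lo)"
    using b_hi[OF i] b_pos[OF i] u hi by (intro mult_mono) auto
  moreover have "K * snd y = snd y + hi * snd y + hi * (snd y / lo)"
    by (simp add: K_def algebra_simps)
  ultimately show ?thesis using v unfolding tame_def rec_step_def fst_conv snd_conv by linarith
qed

lemma tame_run: "tame y \<Longrightarrow> set xs \<subseteq> A \<Longrightarrow> tame (rec_run a b y xs)"
  by (induction xs arbitrary: y) (simp_all add: tame_step)

lemma tame_ln_step:
  assumes "tame y"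
  shows "\<bar>ln (snd y) - ln (fst y)\<bar> \<le> D"
proof -
  have y: "0 < fst y" "lo * fst y \<le> snd y" "snd y \<le> K * fst y" "0 < snd y"
    using assms tame_snd_pos[OF assms] by (auto simp: tame_def)
  have "ln (lo * fst y) \<le> ln (snd y)" "ln (snd y) \<le> ln (K * fst y)"
    using y lo K by (auto intro!: ln_mono)
  then show ?thesis using y lo K D_bounds by (simp add: ln_mult_pos)
qed

lemma tame_ln_total:
  assumes "tame y"
  shows "\<bar>ln (fst y + snd y) - ln (snd y)\<bar> \<le> D"
proof -
  have y: "0 < fst y" "fst y \<le> snd y / lo" "0 < snd y"
    using assms tame_snd_pos[OF assms] lo by (auto simp: tame_def field_simps)
  have "fst y + snd y \<le> (1 + 1 / lo) * snd y" using y by (simp add: algebra_simps)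
  then have "ln (fst y + snd y) \<le> ln ((1 + 1 / lo) * snd y)" using y by (intro ln_mono) auto
  also have "\<dots> = ln (1 + 1 / lo) + ln (snd y)"
    using y lo by (intro ln_mult_pos) (auto intro: add_pos_pos)
  finally have "ln (fst y + snd y) - ln (snd y) \<le> D" using D_bounds by simp
  moreover have "ln (snd y) \<le> ln (fst y + snd y)" using y by simp
  ultimately show ?thesis using D_bounds by simp
qed

lemma rec_run_mono:
  assumes "set xs \<subseteq> A" "0 \<le> fst y" "0 \<le> snd y" "fst y \<le> fst z" "snd y \<le> snd z"
  shows "snd (rec_run a b y xs) \<le> snd (rec_run a b z xs)"
  using assms
proof (induction xs arbitrary: y z)
  case (Cons i xs)
  have i: "i \<in> A" using Cons.prems by simp
  have ab: "0 \<le> a i" "0 \<le> b i" using a_lo[OF i] b_pos[OF i] lo by auto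
  have "b i * fst y \<le> b i * fst z" "a i * snd y \<le> a i * snd z" "0 \<le> b i * fst y" "0 \<le> a i * snd y"
    using Cons.prems ab by (auto intro: mult_left_mono)
  then show ?case using Cons.prems by (auto intro!: Cons.IH simp: rec_step_def)
qed simp

text \<open>The direction of a tame state is within bounded distance of that of \<open>(1, 1)\<close>, so up to a
  bounded error the logarithmic growth over a block does not depend on the past.\<close>

lemma run_restart:
  assumes y: "tame y" and xs: "set xs \<subseteq> A"
  shows "\<bar>ln (snd (rec_run a b y xs)) - ln (snd y) - ln (snd (rec_run a b (1, 1) xs))\<bar> \<le> D"
proof -
  let ?R = "snd (rec_run a b (1, 1) xs)"
  have v: "0 < snd y" by (rule tame_snd_pos[OF y])
  have u: "snd y / K \<le> fst y" "fst y \<le> snd y / lo"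
    using y lo K by (auto simp: tame_def field_simps)
  have R: "0 < ?R" by (intro tame_snd_pos tame_run tame_one xs)
  have Y: "0 < snd (rec_run a b y xs)" by (intro tame_snd_pos tame_run y xs)
  \<comment> \<open>Tameness places \<open>y\<close> coordinatewise between the multiples of
    \<open>(1, 1)\<close> by snd y / K and by snd y / lo; monotonicity and homogeneity carry this
    through the block.\<close>
  have "snd y / K * ?R = snd (rec_run a b (snd y / K * 1, snd y / K * 1) xs)"
    by (simp only: rec_run_scale snd_conv)
  also have "\<dots> \<le> snd (rec_run a b y xs)"
    using u v K by (intro rec_run_mono xs) (auto simp: field_simps mult_le_cancel_left1)
  finally have "ln (snd y / K * ?R) \<le> ln (snd (rec_run a b y xs))"
    using v K R by (intro ln_mono) auto
  moreover have "ln (snd y / K * ?R) = ln (snd y) - ln K + ln ?R"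
    using v K R by (simp add: ln_mult_pos ln_divide_pos)
  moreover have "snd (rec_run a b y xs) \<le> snd (rec_run a b (snd y / lo * 1, snd y / lo * 1) xs)"
    using u v lo y by (intro rec_run_mono xs) (auto simp: field_simps tame_def mult_le_cancel_left1)
  then have "snd (rec_run a b y xs) \<le> snd y / lo * ?R"
    by (simp only: rec_run_scale snd_conv)
  then have "ln (snd (rec_run a b y xs)) \<le> ln (snd y / lo * ?R)"
    using v lo R Y by (intro ln_mono) auto
  moreover have "ln (snd y / lo * ?R) = ln (snd y) - ln lo + ln ?R"
    using v lo R by (simp add: ln_mult_pos ln_divide_pos)
  ultimately show ?thesis using D_bounds by linarith
qed

end

section \<open>Identification of the growth rate and the almost sure limit\<close>

lemma mat2_nth [simp]:
  "mat2 p q r s $ 1 $ 1 = p" "mat2 p q r s $ 1 $ 2 = q"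
  "mat2 p q r s $ 2 $ 1 = r" "mat2 p q r s $ 2 $ 2 = s"
  by (simp_all add: mat2_def)

text \<open>A single companion matrix has a zero entry, while the product of two with positive
  coefficients has none; hence the passage to pairs.\<close>

lemma companion_product:
  "mat2 0 1 p q ** mat2 0 1 r s = mat2 r s (q * r) (p + q * s)"
  by (simp add: vec_eq_iff forall_2 matrix_matrix_mult_def sum_2)

text \<open>The Cesaro means of the mean growth are, up to ln 2 / n, expected logarithms of 2 n
  transposed steps divided by n. By duality these are expected logarithms of the coordinate sum of
  the recurrence, which differ from those of the second coordinate by at most \<open>C.D\<close>. A
  pair is two steps, hence \<open>lyap / 2\<close>.\<close>

lemma block_mean_rate:
  fixes w :: "nat \<Rightarrow> real"
  assumes "bounded_coeffs A a b lo hi" and A: "finite A"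
    and w: "\<And>i. i \<in> A \<Longrightarrow> 0 \<le> w i" "(\<Sum>i\<in>A. w i) = 1"
    and fam: "positive_family (A \<times> A) (\<lambda>(i, j). mat2 0 1 (b i) (a i) ** mat2 0 1 (b j) (a j)) (\<lambda>(i, j). w i * w j)"
  defines "lyap \<equiv> positive_family.growth_rate (A \<times> A)
    (\<lambda>(i, j). mat2 0 1 (b i) (a i) ** mat2 0 1 (b j) (a j)) (\<lambda>(i, j). w i * w j)"
  shows "(\<lambda>L. (\<Sum>xs | set xs \<subseteq> A \<and> length xs = 2 * L. prod_list (map w xs) * ln (snd (rec_run a b (1, 1) xs)))
           / real (2 * L)) \<longlonglongrightarrow> lyap / 2"
proof -
  interpret C: bounded_coeffs A a b lo hi by fact
  interpret F: positive_family "A \<times> A" "\<lambda>(i, j). mat2 0 1 (b i) (a i) ** mat2 0 1 (b j) (a j)" "\<lambda>(i, j). w i * w j"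
    by fact
  define W where "W = (\<lambda>n. {xs. set xs \<subseteq> A \<and> length xs = n})"
  define mu where "mu = (\<lambda>n. \<Sum>xs\<in>W n. prod_list (map w xs) * ln (snd (rec_run a b (1, 1) xs)))"
  define S where "S = (\<lambda>n. \<Sum>k<n. F.mean_growth k 0)"
  have tr: "F.transpose_act = (\<lambda>(i, j) y. dual_step a b j (dual_step a b i y))"
    unfolding F.transpose_act_def fun_eq_iff
    by (auto simp: companion_product dual_step_def algebra_simps)
  \<comment> \<open>The starting vector \<open>(1, 1)\<close> has direction 0, and
    \<open>ln 2\<close> is the logarithm of its coordinate sum.\<close>
  have S: "S n = (\<Sum>xs\<in>W (2 * n). prod_list (map w xs) *
      ln (fst (rec_run a b (1, 1) xs) + snd (rec_run a b (1, 1) xs))) - ln 2" for n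
  proof -
    have "S n = iterated_mean A w (dual_step a b) (2 * n) (\<lambda>y. ln (fst y + snd y)) (1, 1) - ln 2"
      using F.sum_mean_growth[of "(1, 1)" n] by (simp add: S_def tr iterated_mean_pairs)
    also have "iterated_mean A w (dual_step a b) (2 * n) (\<lambda>y. ln (fst y + snd y)) (1, 1) =
        (\<Sum>xs\<in>W (2 * n). prod_list (map w xs) *
          ln (fst (rec_run a b (1, 1) (rev xs)) + snd (rec_run a b (1, 1) (rev xs))))"
      unfolding iterated_mean_eq_sum_lists[OF A] W_def
      using foldl_dual_step[of a b "(1, 1)" _ "(1, 1)"] by (intro sum.cong refl) simp
    also have "\<dots> = (\<Sum>xs\<in>W (2 * n). prod_list (map w xs) *
          ln (fst (rec_run a b (1, 1) xs) + snd (rec_run a b (1, 1) xs)))"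
      \<comment> \<open>Reversing a word preserves its product weight, so the order reversal from
        duality disappears on average.\<close>
      by (rule sum.reindex_bij_witness[of _ rev rev]) (auto simp: W_def rev_map[symmetric])
    finally show ?thesis .
  qed
  have w_lists: "(\<Sum>xs\<in>W n. prod_list (map w xs)) = 1" for n
  proof -
    \<comment> \<open>On a one-point state space the iterated mean of the constant 1 is the total
      weight of all words.\<close>
    have "iterated_mean A w (\<lambda>_ y. y) n (\<lambda>_. 1) () = 1"
      by (induction n) (simp_all add: w flip: sum_distrib_right)
    then show ?thesis
      by (simp add: iterated_mean_eq_sum_lists[OF A] W_def)
  qed
  have diff: "\<bar>S n - mu (2 * n)\<bar> \<le> C.D + ln 2" for n
  proof -
    let ?d = "\<lambda>xs. ln (fst (rec_run a b (1, 1) xs) + snd (rec_run a b (1, 1) xs)) - ln (snd (rec_run a b (1, 1) xs))"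
    have "\<bar>S n + ln 2 - mu (2 * n)\<bar> = \<bar>\<Sum>xs\<in>W (2 * n). prod_list (map w xs) * ?d xs\<bar>"
      by (simp add: S mu_def right_diff_distrib sum_subtractf)
    also have "\<dots> \<le> (\<Sum>xs\<in>W (2 * n). prod_list (map w xs) * C.D)"
    proof (intro order_trans[OF sum_abs] sum_mono)
      fix xs assume xs: "xs \<in> W (2 * n)"
      have "0 \<le> prod_list (map w xs)"
        using xs w by (intro prod_list_nonneg) (auto simp: W_def)
      moreover have "\<bar>?d xs\<bar> \<le> C.D"
        using xs by (intro C.tame_ln_total C.tame_run C.tame_one) (auto simp: W_def)
      ultimately show "\<bar>prod_list (map w xs) * ?d xs\<bar> \<le> prod_list (map w xs) * C.D"
        by (simp add: abs_mult mult_left_mono)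
    qed
    also have "\<dots> = C.D" by (simp add: w_lists flip: sum_distrib_right)
    finally have "\<bar>S n + ln 2 - mu (2 * n)\<bar> \<le> C.D" .
    moreover have "ln 2 \<ge> (0::real)" by simp
    ultimately show ?thesis by linarith
  qed
  have "(\<lambda>n. (mu (2 * n) - S n) / real n) \<longlonglongrightarrow> 0"
  proof (rule Lim_null_comparison)
    show "eventually (\<lambda>n. norm ((mu (2 * n) - S n) / real n) \<le> (C.D + ln 2) / real n) sequentially"
      using diff by (intro always_eventually allI) (simp add: abs_divide abs_minus_commute divide_right_mono)
  qed (rule lim_const_over_n)
  moreover have "(\<lambda>n. S n / real n) \<longlonglongrightarrow> lyap"
    unfolding S_def lyap_def by (rule tendsto_arithmetic_means[OF F.mean_growth_tendsto])
  ultimately have "(\<lambda>n. (S n / real n + (mu (2 * n) - S n) / real n) / 2) \<longlonglongrightarrow> (lyap + 0) / 2"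
    by (intro tendsto_intros) auto
  moreover have "(S n / real n + (mu (2 * n) - S n) / real n) / 2 = mu (2 * n) / real (2 * n)" for n
    by (simp flip: add_divide_distrib)
  ultimately show ?thesis
    by (simp add: mu_def W_def mult.commute)
qed

theorem proposition1p14:
  fixes m :: nat
    and a b w :: "nat \<Rightarrow> real"
    and P :: "'o measure"
    and idx :: "nat \<Rightarrow> 'o \<Rightarrow> nat"
    and x :: "nat \<Rightarrow> 'o \<Rightarrow> real"
  assumes ab_pos: "\<And>i. i \<in> {1..m} \<Longrightarrow> a i > 0 \<and> b i > 0"
    and w_pos: "\<And>i. i \<in> {1..m} \<Longrightarrow> w i > 0"
    and w_sum: "(\<Sum>i = 1..m. w i) = 1"
    and P: "prob_space P"
    and idx_indep: "prob_space.indep_vars P (\<lambda>_. count_space {1..m}) idx {2..}"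
    and idx_law: "\<And>n i. n \<ge> 2 \<Longrightarrow> i \<in> {1..m} \<Longrightarrow>
                    measure P {\<xi> \<in> space P. idx n \<xi> = i} = w i"
    and x_init: "\<And>\<xi>. \<xi> \<in> space P \<Longrightarrow> x 0 \<xi> = 1 \<and> x 1 \<xi> = 1"
    and x_rec: "\<And>n \<xi>. n \<ge> 1 \<Longrightarrow> \<xi> \<in> space P \<Longrightarrow>
                  x (n + 1) \<xi> = a (idx (n + 1) \<xi>) * x n \<xi> + b (idx (n + 1) \<xi>) * x (n - 1) \<xi>"
  defines "M \<equiv> \<lambda>i. mat2 0 1 (b i) (a i)"
  defines "I \<equiv> {1..m} \<times> {1..m}"
  defines "B \<equiv> \<lambda>(i, j). M i ** M j"
  defines "\<omega> \<equiv> \<lambda>(i, j). w i * w j"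
  defines "T \<equiv> T_mat I B \<omega>"
  defines "v \<equiv> bold_v I B \<omega>"
  shows "(\<forall>i\<in>{1..m}. \<forall>j\<in>{1..m}. positive_matrix (M i ** M j)) \<and>
         (\<forall>k j. summable (\<lambda>n. T j n * (inf_mat_apply T ^^ k) v n)) \<and>
         summable (\<lambda>k. (inf_mat_apply T ^^ k) v 0) \<and>
         (AE \<xi> in P. (\<lambda>n. complex_of_real (root n (x n \<xi>)))
            \<longlonglongrightarrow> exp (1/2 * (\<Sum>k. (inf_mat_apply T ^^ k) v 0)))"
proof -
  define A where "A = {1..m}"
  have A: "finite A" by (simp add: A_def)
  note ab = ab_pos[folded A_def] and w0 = w_pos[folded A_def]
  \<comment> \<open>The inserted 1 secures \<open>lo \<le> 1\<close> here and
    \<open>hi \<ge> 0\<close> in the next line.\<close>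
  define lo where "lo = Min (insert 1 (a ` A))"
  define hi where "hi = Max (insert 1 (a ` A \<union> b ` A))"
  have C: "bounded_coeffs A a b lo hi"
  proof
    show "0 < lo" using A ab by (auto simp: lo_def)
    show "lo \<le> 1" using A by (simp add: lo_def)
    show "0 \<le> hi" using A by (auto simp: hi_def intro!: order_trans[OF zero_le_one Max_ge])
  qed (use A ab in \<open>auto simp: lo_def hi_def\<close>)
  then interpret C: bounded_coeffs A a b lo hi .
  have B_pos: "positive_matrix (M i ** M j)" if "i \<in> A" "j \<in> A" for i j
    using ab[OF that(1)] ab[OF that(2)]
    by (auto simp: positive_matrix_def M_def companion_product forall_2 intro!: add_pos_pos)
  have B_det: "det (M i ** M j) \<noteq> 0" if "i \<in> A" "j \<in> A" for i j
    using ab[OF that(1)] ab[OF that(2)]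
    by (simp add: M_def companion_product det_2 algebra_simps)
  have B_eq: "B = (\<lambda>(i, j). mat2 0 1 (b i) (a i) ** mat2 0 1 (b j) (a j))"
    by (simp add: B_def M_def)
  have F: "positive_family I B \<omega>"
  proof
    show "finite I" by (simp add: I_def)
    show "sum \<omega> I = 1"
      unfolding I_def \<omega>_def using w_sum by (simp add: sum.cartesian_product[symmetric] flip: sum_distrib_left)
  qed (use B_pos B_det w0 in \<open>auto simp: I_def B_def \<omega>_def A_def less_imp_le\<close>)
  then interpret F: positive_family I B \<omega> .
  have sums: "(\<lambda>k. (inf_mat_apply T ^^ k) v 0) sums of_real F.growth_rate"
    unfolding T_def v_def by (rule F.T_iterate_0_sums)
  have smbl: "summable (\<lambda>n. T j n * (inf_mat_apply T ^^ k) v n)" for j k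
    unfolding T_def v_def by (rule F.T_iterate_summable)
  define mu where "mu = (\<lambda>p. \<Sum>xs | set xs \<subseteq> A \<and> length xs = p. prod_list (map w xs) * ln (snd (rec_run a b (1, 1) xs)))"
  have mu: "(\<lambda>L. mu (2 * L) / real (2 * L)) \<longlonglongrightarrow> F.growth_rate / 2"
    using block_mean_rate[OF C A, of w] F w0 w_sum
    unfolding mu_def B_eq I_def \<omega>_def A_def by (simp add: less_imp_le)
  interpret prob_space P by (rule P)
  note indep = idx_indep[folded A_def]
  \<comment> \<open>The logarithmic growth over block \<open>j\<close> restarted at
    \<open>(1, 1)\<close>. The indices begin at 2 because \<open>idx 2\<close> produces the first
    random term, so block \<open>j\<close> leads from the term with index 1 + j p to the one with
    index 1 + (j + 1) p.\<close>
  define Z where "Z = (\<lambda>p j \<xi>. ln (snd (rec_run a b (1, 1) (map (\<lambda>i. idx i \<xi>) [2 + j * p..<2 + j * p + p]))))"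
  \<comment> \<open>There are countably many block lengths, so one null set serves them all, and
    \<open>p\<close> may be chosen afterwards for a fixed \<xi>.\<close>
  have "AE \<xi> in P. \<forall>p. (\<lambda>n. (\<Sum>j<n. Z p j \<xi>) / real n) \<longlonglongrightarrow> mu p"
    unfolding AE_all_countable Z_def mu_def
    by (intro allI strong_law_blocks[OF indep A, where f = "\<lambda>xs. ln (snd (rec_run a b (1, 1) xs))"])
       (simp_all add: idx_law A_def)
  then have "AE \<xi> in P. (\<lambda>n. complex_of_real (root n (x n \<xi>))) \<longlonglongrightarrow> exp (1/2 * of_real F.growth_rate)"
  proof (rule AE_mp, intro AE_I2 impI)
    fix \<xi> assume \<xi>: "\<xi> \<in> space P" and lim: "\<forall>p. (\<lambda>n. (\<Sum>j<n. Z p j \<xi>) / real n) \<longlonglongrightarrow> mu p"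
    have idx: "idx n \<xi> \<in> A" if "n \<ge> 2" for n
      using indep \<xi> that by (auto simp: indep_vars_def dest!: measurable_space)
    have run: "rec_run a b (x n \<xi>, x (Suc n) \<xi>) (map (\<lambda>i. idx i \<xi>) [n + 2..<n + 2 + N]) =
        (x (n + N) \<xi>, x (Suc (n + N)) \<xi>)" for n N
    proof (induction N)
      case (Suc N)
      have "x (Suc (Suc (n + N))) \<xi> = a (idx (Suc (Suc (n + N))) \<xi>) * x (Suc (n + N)) \<xi> + b (idx (Suc (Suc (n + N))) \<xi>) * x (n + N) \<xi>"
        using x_rec[of "Suc (n + N)" \<xi>] \<xi> by simp
      then show ?case using Suc by (simp add: rec_step_def)
    qed simp
    have tame: "C.tame (x n \<xi>, x (Suc n) \<xi>)" for n
    proof -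
      have "set (map (\<lambda>i. idx i \<xi>) [0 + 2..<0 + 2 + n]) \<subseteq> A" using idx by auto
      from C.tame_run[OF C.tame_one this] run[of 0 n] x_init[OF \<xi>] show ?thesis by simp
    qed
    have x_pos: "x n \<xi> > 0" for n
      using tame[of n] by (simp add: C.tame_def)
    define y where "y = (\<lambda>n. ln (x n \<xi>))"
    \<comment> \<open>Each of the \<open>j\<close> restarts costs at most \<open>C.D\<close> by
      \<open>C.run_restart\<close>; the initial value ln (x 1 \<xi>) is 0.\<close>
    have blocks: "\<bar>y (1 + p * j) - (\<Sum>i<j. Z p i \<xi>)\<bar> \<le> real j * C.D" for p j
    proof (induction j)
      case 0
      then show ?case using x_init[OF \<xi>] by (simp add: y_def)
    next
      case (Suc j)
      have "set (map (\<lambda>i. idx i \<xi>) [p * j + 2..<p * j + 2 + p]) \<subseteq> A" using idx by auto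
      from C.run_restart[OF tame[of "p * j"] this]
      have "\<bar>y (1 + p * Suc j) - y (1 + p * j) - Z p j \<xi>\<bar> \<le> C.D"
        unfolding run by (simp add: y_def Z_def add.commute mult.commute del: upt_Suc)
      with Suc show ?case by (simp add: distrib_right)
    qed
    have "(\<lambda>n. y n / real n) \<longlonglongrightarrow> F.growth_rate / 2"
    proof (rule tendsto_of_block_approximations[OF _ _ blocks _ mu])
      show "\<bar>y (Suc n) - y n\<bar> \<le> C.D" for n
        using C.tame_ln_step[OF tame[of n]] by (simp add: y_def)
    qed (use lim C.D_bounds in auto)
    then have "(\<lambda>n. exp (y n / real n)) \<longlonglongrightarrow> exp (F.growth_rate / 2)"
      by (intro tendsto_exp)
    moreover have "eventually (\<lambda>n. exp (y n / real n) = root n (x n \<xi>)) sequentially"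
      using eventually_gt_at_top[of 0]
    proof eventually_elim
      case (elim n)
      then show ?case
        using x_pos[of n] by (simp add: y_def root_powr_inverse powr_def)
    qed
    ultimately have "(\<lambda>n. root n (x n \<xi>)) \<longlonglongrightarrow> exp (F.growth_rate / 2)"
      by (rule Lim_transform_eventually)
    then have "(\<lambda>n. complex_of_real (root n (x n \<xi>))) \<longlonglongrightarrow> of_real (exp (F.growth_rate / 2))"
      by (rule tendsto_of_real)
    then show "(\<lambda>n. complex_of_real (root n (x n \<xi>))) \<longlonglongrightarrow> exp (1/2 * of_real F.growth_rate)"
      by (simp flip: exp_of_real)
  qed
  then show ?thesis
    using B_pos smbl sums_summable[OF sums] sums_unique[OF sums] by (simp add: A_def)
qed

end
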